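(* For each $\rho\in [1/2,\infty)$ there exists a function $f\in B$ with $\lambda(f)=\rho(f)=\rho$ such that if $z\in \mathbb{C}$ satisfies $\chi(f,z)=\infty$, then $$\limsup_{n\to\infty} \frac{1}{n} \log \log (f^n)^\#(z) \leq \log (1+ \rho).$$
   Context: The Eremenko-Lyubich class $B$ consists of all transcendental entire functions for which the set of critical values and finite asymptotic values is bounded. With $M(r,f)=\max_{|z|=r}|f(z)|$, the lower order and order of an entire function $f$ are $\lambda(f)=\liminf_{r\to\infty}\frac{\log\log M(r,f)}{\log r}$ and $\rho(f)=\limsup_{r\to\infty}\frac{\log\log M(r,f)}{\log r}$. $f^n$ denotes the $n$-th iterate of $f$. For an entire function $g$, the spherical derivative is $g^\#(z)=\frac{|g'(z)|}{1+|g(z)|^2}$. The condition $\chi(f,z)=\infty$ means that $\lim_{n\to\infty}\frac1n\log (f^n)^\#(z)=\infty$; in particular $(f^n)^\#(z)>1$ for all large $n$, so $\log\log (f^n)^\#(z)$ is defined for large $n$. *)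

theory Defs
  imports
    "HOL-Complex_Analysis.Complex_Analysis"
    "HOL-Computational_Algebra.Polynomial"
begin

definition transcendental_entire :: "(complex \<Rightarrow> complex) \<Rightarrow> bool" where
  "transcendental_entire f \<longleftrightarrow> f holomorphic_on UNIV \<and> \<not> (\<exists>p. f = poly p)"

definition critical_values :: "(complex \<Rightarrow> complex) \<Rightarrow> complex set" where
  "critical_values f = f ` {z. deriv f z = 0}"

definition asymptotic_values :: "(complex \<Rightarrow> complex) \<Rightarrow> complex set" where
  "asymptotic_values f =
     {a. \<exists>\<gamma> :: real \<Rightarrow> complex. continuous_on {0..} \<gamma> \<and>
           filterlim \<gamma> at_infinity at_top \<and> ((\<lambda>t. f (\<gamma> t)) \<longlongrightarrow> a) at_top}"

definition eremenko_lyubich_class :: "(complex \<Rightarrow> complex) set" where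
  "eremenko_lyubich_class =
     {f. transcendental_entire f \<and> bounded (critical_values f \<union> asymptotic_values f)}"

definition max_modulus :: "real \<Rightarrow> (complex \<Rightarrow> complex) \<Rightarrow> real" where
  "max_modulus r f = (SUP z\<in>sphere 0 r. norm (f z))"

lemma max_modulus_attained:
  assumes "continuous_on UNIV f" and "0 \<le> r"
  shows "\<exists>z. norm z = r \<and> max_modulus r f = norm (f z) \<and> (\<forall>w. norm w = r \<longrightarrow> norm (f w) \<le> norm (f z))"
proof -
  have "continuous_on (sphere 0 r) (\<lambda>z. norm (f z))"
    using assms(1) by (intro continuous_on_norm) (rule continuous_on_subset, auto)
  moreover have "sphere (0::complex) r \<noteq> {}"
    using assms(2) by simp
  ultimately obtain z where z: "z \<in> sphere 0 r" "\<And>w. w \<in> sphere 0 r \<Longrightarrow> norm (f w) \<le> norm (f z)"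
    using continuous_attains_sup[of "sphere (0::complex) r" "\<lambda>z. norm (f z)"] by auto
  have "max_modulus r f = norm (f z)"
    unfolding max_modulus_def by (rule cSup_eq_maximum) (use z in auto)
  with z show ?thesis by (intro exI[of _ z]) auto
qed

(* Since ln is total, the next two definitions agree with the usual ones only for entire f with
   max_modulus r f > 1 for all large r, i.e. for every nonconstant entire f. *)

definition lower_growth_order :: "(complex \<Rightarrow> complex) \<Rightarrow> ereal" where
  "lower_growth_order f = Liminf at_top (\<lambda>r. ereal (ln (ln (max_modulus r f)) / ln r))"

definition growth_order :: "(complex \<Rightarrow> complex) \<Rightarrow> ereal" where
  "growth_order f = Limsup at_top (\<lambda>r. ereal (ln (ln (max_modulus r f)) / ln r))"

definition spherical_deriv :: "(complex \<Rightarrow> complex) \<Rightarrow> complex \<Rightarrow> real" where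
  "spherical_deriv g z = norm (deriv g z) / (1 + (norm (g z))\<^sup>2)"

(* The convention ln 0 = 0 is harmless: a spherical derivative vanishing for infinitely many n
   rules out divergence to infinity under this convention as well as under ln 0 = -infinity. *)
definition infinite_lyapunov_exponent :: "(complex \<Rightarrow> complex) \<Rightarrow> complex \<Rightarrow> bool" where
  "infinite_lyapunov_exponent f z \<longleftrightarrow>
     filterlim (\<lambda>n. 1 / real n * ln (spherical_deriv (f ^^ n) z)) at_top sequentially"

end

theory Submission
  imports Defs
    "HOL-Computational_Algebra.Fundamental_Theorem_Algebra"
    "HOL-Probability.Sinc_Integral"
    "HOL-Real_Asymp.Real_Asymp"
begin

text \<open>
  The bound on the growth of the spherical derivative follows from a pointwise bound on \<open>f'\<close>.
  Write \<open>z\<^sub>k\<close> for the \<open>k\<close>-th iterate of \<open>z\<close> and \<open>a\<^sub>k = ln (1 + \<bar>z\<^sub>k\<bar>)\<close>, and suppose that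
  \<open>\<bar>f'(z)\<bar> \<le> C (1 + \<bar>f(z)\<bar>) (1 + \<bar>z\<bar>) powr (\<rho> - 1)\<close> holds in the whole plane.
  By the chain rule, the factors \<open>1 + \<bar>z\<^sub>k\<bar>\<close> telescope and the logarithm of the spherical derivative
  of the \<open>n\<close>-th iterate is at most \<open>\<rho> S\<^sub>n - a\<^sub>n + O(n)\<close>, where
  \<open>S\<^sub>n\<close> is the sum of the \<open>a\<^sub>k\<close> with \<open>k < n\<close>. If the Lyapunov exponent is infinite,
  then this quantity is eventually positive, so \<open>a\<^sub>n \<le> \<rho> S\<^sub>n + O(n)\<close> and hence
  \<open>S\<^sub>n\<^sub>+\<^sub>1 \<le> (1 + \<rho>) S\<^sub>n + O(n)\<close>. Thus \<open>S\<^sub>n\<close>, and with it the logarithm of the spherical derivative, is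
  \<open>O((1 + \<rho>) ^ n)\<close>; this is the lemma \<open>limsup_log_log_spherical_deriv_le\<close>.

  The pointwise bound can fail for functions of class \<open>B\<close>, and the work lies in finding
  a function of order and lower order \<open>\<rho>\<close> which satisfies it. The model is the Mittag-Leffler function, which
  is close to a multiple of \<open>exp (z powr \<rho>)\<close> where the latter is large and is bounded elsewhere. For
  \<open>1 < s < 2\<close> the function \<open>H(w) = exp (w powr s)\<close> is holomorphic in the right half plane and
  decays rapidly along vertical lines. The Cauchy integral of \<open>H\<close> over the line \<open>Re t = \<sigma>\<close> is holomorphic to
  the left of this line, and moving the line to the right does not change it. So these integrals define an
  entire function \<open>f\<close>, which is bounded to the left of the line \<open>Re w = 3\<close>, while Cauchy's
  formula shows that \<open>f - H\<close> is bounded to the right of \<open>Re w = 2\<close>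
  (\<open>entire_approximation\<close>). For \<open>s = 1\<close> the exponential function itself serves.

  The orders \<open>\<rho> \<ge> 1/2\<close> are reached by writing \<open>\<rho> = k s / 2\<close> with an integer \<open>k \<ge> 1\<close> and
  \<open>1 \<le> s < 2\<close>, and by taking \<open>F(z) = f(u) + f(- u)\<close> with \<open>u\<^sup>2 = z ^ k\<close>; this is entire since it is an even
  function of \<open>u\<close>. Choosing \<open>u\<close> in the closed right half plane, \<open>F(z)\<close> differs from
  \<open>exp (u powr s)\<close>, or from \<open>0\<close>, by a bounded amount, and Cauchy's estimates give the corresponding
  statement for the derivative with respect to \<open>u\<close>. From this one reads off the orders, the pointwise bound, and
  that critical values are bounded. Asymptotic values are bounded because along a curve to infinity on which \<open>F\<close> has a
  limit of large modulus, \<open>exp (u powr s)\<close> would stay in a disc which does not contain \<open>0\<close>,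
  so its logarithm \<open>u powr s\<close> would be bounded.
\<close>

section \<open>Growth of the spherical derivative under a pointwise bound\<close>

lemma has_field_derivative_funpow:
  fixes f :: "complex \<Rightarrow> complex"
  assumes "f holomorphic_on UNIV"
  shows "((f ^^ n) has_field_derivative (\<Prod>k<n. deriv f ((f ^^ k) z))) (at z)"
proof (induction n)
  case 0
  then show ?case by (simp add: id_def)
next
  case (Suc n)
  have "(f has_field_derivative deriv f ((f ^^ n) z)) (at ((f ^^ n) z))"
    using assms by (simp add: holomorphic_derivI)
  from DERIV_chain[OF this Suc.IH] show ?case
    by (simp only: funpow.simps prod.lessThan_Suc mult.commute)
qed

text \<open>
  In the product of the bounds, the factor \<open>1 + \<bar>f(z\<^sub>k)\<bar>\<close> of one step combines with the factor
  \<open>(1 + \<bar>z\<^sub>k\<^sub>+\<^sub>1\<bar>) powr (\<rho> - 1)\<close> of the next one to the power \<open>\<rho>\<close>. Only the first and the last point are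
  left over; dividing by \<open>1 + \<bar>z\<^sub>n\<bar>\<^sup>2\<close> turns the last contribution into \<open>- a\<^sub>n\<close>. It is this negative sign that
  limits the size of the next point once the spherical derivative is known to be large.
\<close>

lemma spherical_deriv_funpow_le:
  fixes f :: "complex \<Rightarrow> complex"
  defines "a \<equiv> \<lambda>z k. ln (1 + norm ((f ^^ k) z))"
  assumes "f holomorphic_on UNIV"
    and bound: "\<And>z. norm (deriv f z) \<le> exp c * (1 + norm (f z)) * (1 + norm z) powr (\<rho> - 1)"
  shows "spherical_deriv (f ^^ n) z \<le> 2 * exp (c * real n + \<rho> * (\<Sum>k<n. a z k) - a z n)"
proof -
  have exp_a: "exp (a z k) = 1 + norm ((f ^^ k) z)" for k
    by (simp add: a_def add_pos_nonneg)
  have step: "norm (deriv f ((f ^^ k) z)) \<le> exp (c + a z (Suc k) + (\<rho> - 1) * a z k)" for k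
  proof -
    have "(1 + norm ((f ^^ k) z)) powr (\<rho> - 1) = exp ((\<rho> - 1) * a z k)"
      by (smt (verit) a_def norm_ge_zero powr_def)
    then show ?thesis
      using bound[of "(f ^^ k) z"] exp_a[of "Suc k"] by (simp add: exp_add)
  qed
  have "norm (deriv (f ^^ n) z) = (\<Prod>k<n. norm (deriv f ((f ^^ k) z)))"
    using DERIV_imp_deriv[OF has_field_derivative_funpow[OF assms(2)]] by (simp add: prod_norm)
  also have "\<dots> \<le> (\<Prod>k<n. exp (c + a z (Suc k) + (\<rho> - 1) * a z k))"
    by (intro prod_mono) (simp add: step)
  also have "\<dots> = exp (\<Sum>k<n. c + a z (Suc k) + (\<rho> - 1) * a z k)"
    by (simp add: exp_sum)
  also have "(\<Sum>k<n. c + a z (Suc k) + (\<rho> - 1) * a z k) = c * real n + a z n - a z 0 + \<rho> * (\<Sum>k<n. a z k)"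
    by (induction n) (auto simp: algebra_simps)
  also have "exp \<dots> \<le> exp (c * real n + a z n + \<rho> * (\<Sum>k<n. a z k))"
    by (simp add: a_def)
  finally have D: "norm (deriv (f ^^ n) z) \<le> exp (c * real n + a z n + \<rho> * (\<Sum>k<n. a z k))" .
  have "exp (a z n) * exp (a z n) \<le> 2 * (1 + (norm ((f ^^ n) z))\<^sup>2)"
    unfolding exp_a using sum_squares_ge_zero[of "1 - norm ((f ^^ n) z)" 0]
    by (simp add: power2_eq_square algebra_simps)
  then have E: "1 / (1 + (norm ((f ^^ n) z))\<^sup>2) \<le> 2 / (exp (a z n) * exp (a z n))"
    by (simp add: field_simps add_pos_nonneg)
  have "spherical_deriv (f ^^ n) z
      \<le> exp (c * real n + a z n + \<rho> * (\<Sum>k<n. a z k)) * (2 / (exp (a z n) * exp (a z n)))"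
    unfolding spherical_deriv_def using mult_mono[OF D E] by simp
  also have "\<dots> = 2 * exp (c * real n + \<rho> * (\<Sum>k<n. a z k) - a z n)"
    by (simp add: exp_add exp_diff)
  finally show ?thesis .
qed

lemma limsup_log_log_spherical_deriv_le:
  fixes f :: "complex \<Rightarrow> complex"
  assumes hol: "f holomorphic_on UNIV" and "\<rho> > 0"
    and bound: "\<And>z. norm (deriv f z) \<le> C * (1 + norm (f z)) * (1 + norm z) powr (\<rho> - 1)"
    and inf: "infinite_lyapunov_exponent f z"
  shows "limsup (\<lambda>n. ereal (1 / real n * ln (ln (spherical_deriv (f ^^ n) z)))) \<le> ereal (ln (1 + \<rho>))"
proof -
  define c where "c = ln (max 1 C)"
  have "c \<ge> 0" "C \<le> exp c"
    by (auto simp: c_def)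
  then have bound': "norm (deriv f z) \<le> exp c * (1 + norm (f z)) * (1 + norm z) powr (\<rho> - 1)" for z
    by (intro order_trans[OF bound] mult_right_mono) (auto simp: add_nonneg_nonneg)
  define a where "a = (\<lambda>k. ln (1 + norm ((f ^^ k) z)))"
  define S where "S = (\<lambda>n. \<Sum>k<n. a k)"
  define D where "D = (\<lambda>n. spherical_deriv (f ^^ n) z)"
  have a_nonneg: "a k \<ge> 0" for k by (simp add: a_def)
  have D_le: "D n \<le> 2 * exp (c * real n + \<rho> * S n - a n)" for n
    using spherical_deriv_funpow_le[OF hol bound'] by (simp add: D_def S_def a_def)
  have "\<forall>\<^sub>F n in sequentially. 1 \<le> 1 / real n * ln (D n)"
    using inf unfolding infinite_lyapunov_exponent_def filterlim_at_top D_def by blast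
  then obtain N0 where "\<And>n. n \<ge> N0 \<Longrightarrow> 1 \<le> 1 / real n * ln (D n)"
    unfolding eventually_sequentially by blast
  then obtain N where N: "N > 0" "\<And>n. n \<ge> N \<Longrightarrow> 1 \<le> 1 / real n * ln (D n)"
    by (metis max.cobounded1 max.cobounded2 le_trans zero_less_one max_def less_le_trans)
  have lnD_ge: "real n \<le> ln (D n)" if "n \<ge> N" for n
    using N(2)[OF that] N(1) that by (simp add: field_simps)
  have D_pos: "D n > 0" if "n \<ge> N" for n
  proof -
    have "D n \<ge> 0" by (simp add: D_def spherical_deriv_def)
    moreover have "ln (D n) > 0" using lnD_ge[OF that] N(1) that by linarith
    ultimately show ?thesis by (metis less_eq_real_def ln_0 order_less_irrefl)
  qed
  have lnD_le: "ln (D n) \<le> 1 + c * real n + \<rho> * S n - a n" if "n \<ge> N" for n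
  proof -
    have "ln (D n) \<le> ln (2 * exp (c * real n + \<rho> * S n - a n))"
      using D_le D_pos[OF that] by simp
    also have "\<dots> = ln 2 + (c * real n + \<rho> * S n - a n)"
      by (subst ln_mult) auto
    finally show ?thesis using ln2_le_25_over_36 by linarith
  qed
  \<comment> \<open>The affine correction absorbs the inhomogeneous term of the recursion.\<close>
  define \<alpha> where "\<alpha> = c / \<rho>"
  define \<beta> where "\<beta> = (1 + \<alpha>) / \<rho>"
  define T where "T = (\<lambda>n. S n + \<alpha> * real n + \<beta>)"
  have \<alpha>\<beta>: "\<rho> * \<alpha> = c" "\<rho> * \<beta> = 1 + \<alpha>" "\<alpha> \<ge> 0" "\<beta> \<ge> 0"
    using \<open>\<rho> > 0\<close> \<open>c \<ge> 0\<close> by (auto simp: \<alpha>_def \<beta>_def)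
  have \<rho>T: "\<rho> * T n = \<rho> * S n + c * real n + 1 + \<alpha>" for n
    using \<alpha>\<beta>(1,2) by (auto simp: T_def algebra_simps mult.assoc[symmetric])
  have T_Suc: "T (Suc n) \<le> (1 + \<rho>) * T n" if "n \<ge> N" for n
  proof -
    have "a n \<le> 1 + c * real n + \<rho> * S n"
      using lnD_le[OF that] lnD_ge[OF that] by linarith
    then show ?thesis
      using \<rho>T[of n] by (simp add: T_def S_def algebra_simps)
  qed
  have T_nonneg: "T n \<ge> 0" for n
    using \<alpha>\<beta> a_nonneg by (auto simp: T_def S_def intro!: add_nonneg_nonneg sum_nonneg)
  have T_le: "T n \<le> T N * (1 + \<rho>) ^ n" if "n \<ge> N" for n
    using that
  proof (induction n rule: dec_induct)
    case base
    have "1 \<le> (1 + \<rho>) ^ N" using \<open>\<rho> > 0\<close> by simp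
    then show ?case using T_nonneg[of N] mult_left_mono by fastforce
  next
    case (step n)
    have "T (Suc n) \<le> (1 + \<rho>) * T n" using T_Suc step by simp
    also have "\<dots> \<le> (1 + \<rho>) * (T N * (1 + \<rho>) ^ n)"
      using step \<open>\<rho> > 0\<close> by (intro mult_left_mono) auto
    finally show ?case by (simp add: algebra_simps)
  qed
  define K where "K = \<rho> * T N + 1"
  have "K > 0" using T_nonneg[of N] \<open>\<rho> > 0\<close> by (simp add: K_def add_nonneg_pos)
  have main: "1 / real n * ln (ln (D n)) \<le> ln K / real n + ln (1 + \<rho>)" if "n \<ge> N" for n
  proof -
    have "ln (D n) \<le> \<rho> * T n"
      using lnD_le[OF that] \<rho>T[of n] \<alpha>\<beta>(3) a_nonneg[of n] by linarith
    also have "\<dots> \<le> \<rho> * (T N * (1 + \<rho>) ^ n)"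
      using T_le[OF that] \<open>\<rho> > 0\<close> by simp
    also have "\<dots> \<le> K * (1 + \<rho>) ^ n"
      using \<open>\<rho> > 0\<close> by (simp add: K_def algebra_simps)
    finally have "ln (ln (D n)) \<le> ln (K * (1 + \<rho>) ^ n)"
      using lnD_ge[OF that] N(1) that by (subst ln_le_cancel_iff) (auto intro: less_le_trans)
    also have "\<dots> = ln K + real n * ln (1 + \<rho>)"
      using \<open>K > 0\<close> \<open>\<rho> > 0\<close> by (simp add: ln_mult ln_realpow)
    finally show ?thesis using N(1) that by (simp add: field_simps)
  qed
  have "(\<lambda>n. ereal (ln K / real n + ln (1 + \<rho>))) \<longlonglongrightarrow> ereal (0 + ln (1 + \<rho>))"
    by (intro tendsto_ereal tendsto_add tendsto_const lim_const_over_n)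
  then have "limsup (\<lambda>n. ereal (ln K / real n + ln (1 + \<rho>))) = ereal (ln (1 + \<rho>))"
    unfolding add_0 by (rule lim_imp_Limsup[OF trivial_limit_sequentially])
  moreover have "limsup (\<lambda>n. ereal (1 / real n * ln (ln (D n))))
      \<le> limsup (\<lambda>n. ereal (ln K / real n + ln (1 + \<rho>)))"
    using main by (intro Limsup_mono) (auto simp: eventually_sequentially)
  ultimately show ?thesis by (simp add: D_def)
qed

section \<open>Cauchy integrals over vertical lines\<close>

lemma integrable_quadratic_decay:
  fixes h :: "real \<Rightarrow> complex"
  assumes "continuous_on UNIV h" and bound: "\<And>y. norm (h y) \<le> K / (1 + y\<^sup>2)"
  shows "integrable lborel h" and "norm (LINT y|lborel. h y) \<le> K * pi"
proof -
  have int: "integrable lborel (\<lambda>y. K / (1 + y\<^sup>2))"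
    using integrable_inverse_1_plus_square
    by (auto simp: set_integrable_def divide_inverse)
  have val: "(LINT y|lborel. K / (1 + y\<^sup>2)) = K * pi"
    using LBINT_inverse_1_plus_square
    by (simp add: interval_lebesgue_integral_def set_lebesgue_integral_def divide_inverse)
  show "integrable lborel h"
    by (rule Bochner_Integration.integrable_bound[OF int])
      (use assms order_trans[OF bound abs_ge_self] in
        \<open>auto intro!: borel_measurable_continuous_onI\<close>)
  then show "norm (LINT y|lborel. h y) \<le> K * pi"
    using Bochner_Integration.integral_norm_bound_integral[OF _ int] bound val by auto
qed

text \<open>
  Rectangles produce integrals over \<open>{-n..n}\<close>; this passes to the whole line.
\<close>

lemma integral_symmetric_interval_tendsto:
  fixes h :: "real \<Rightarrow> complex"
  assumes h: "integrable lborel h"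
  shows "(\<lambda>n. integral {- real n..real n} h) \<longlonglongrightarrow> (LINT y|lborel. h y)"
proof -
  have "(\<lambda>n. LINT y|lborel. indicator {- real n..real n} y *\<^sub>R h y) \<longlonglongrightarrow> (LINT y|lborel. h y)"
  proof (rule integral_dominated_convergence[where w = "\<lambda>y. norm (h y)"])
    show "AE y in lborel. (\<lambda>n. indicator {- real n..real n} y *\<^sub>R h y) \<longlonglongrightarrow> h y"
    proof (rule AE_I2, rule tendsto_eventually)
      fix y :: real
      obtain N :: nat where "\<bar>y\<bar> \<le> real N" using real_arch_simple by blast
      then have "y \<in> {- real n..real n}" if "n \<ge> N" for n
        using that by auto
      then show "\<forall>\<^sub>F n in sequentially. indicator {- real n..real n} y *\<^sub>R h y = h y"
        by (auto simp: eventually_sequentially indicator_def intro!: exI[of _ N])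
    qed
  qed (use h in \<open>auto split: split_indicator\<close>)
  moreover have "(LINT y|lborel. indicator {- real n..real n} y *\<^sub>R h y) = integral {- real n..real n} h" for n
    using set_borel_integral_eq_integral(2)[of "{- real n..real n}" h]
      integrable_mult_indicator[OF _ h, of "{- real n..real n}"]
    by (simp add: set_lebesgue_integral_def set_integrable_def)
  ultimately show ?thesis by simp
qed

definition vertical_cauchy_integral :: "(complex \<Rightarrow> complex) \<Rightarrow> real \<Rightarrow> complex \<Rightarrow> complex" where
  "vertical_cauchy_integral H \<sigma> w = (LINT y|lborel. H (Complex \<sigma> y) / (Complex \<sigma> y - w)) / (2 * pi)"

text \<open>
  The lines of integration all lie in \<open>Re t \<ge> 1\<close>, away from the boundary of the half plane, where \<open>H\<close> can be singular.
\<close>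

locale strip_decay =
  fixes H :: "complex \<Rightarrow> complex"
  assumes hol: "H holomorphic_on {t. Re t > 0}"
    and decay: "\<And>b. \<exists>C. \<forall>t. 1 \<le> Re t \<and> Re t \<le> b \<longrightarrow> norm (H t) \<le> C / (1 + (Im t)\<^sup>2)"
begin

lemma line_continuous: "\<sigma> > 0 \<Longrightarrow> continuous_on UNIV (\<lambda>y. H (Complex \<sigma> y))"
  by (rule continuous_on_compose2[OF holomorphic_on_imp_continuous_on[OF hol]])
    (auto simp: Complex_eq intro!: continuous_intros)

text \<open>
  All kernels that occur below are bounded continuous functions on the line, so this single estimate settles
  integrability and size of every integral.
\<close>

lemma line_integral_weighted_bound:
  assumes "\<sigma> \<ge> 1"
  shows "\<exists>C\<ge>0. \<forall>q K. continuous_on UNIV q \<longrightarrow> (\<forall>y. norm (q y) \<le> K) \<longrightarrow>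
       integrable lborel (\<lambda>y. H (Complex \<sigma> y) * q y) \<and>
       norm (LINT y|lborel. H (Complex \<sigma> y) * q y) \<le> C * K"
proof -
  obtain C where C: "\<And>t. \<lbrakk>1 \<le> Re t; Re t \<le> \<sigma>\<rbrakk> \<Longrightarrow> norm (H t) \<le> C / (1 + (Im t)\<^sup>2)"
    using decay by blast
  have bd: "norm (H (Complex \<sigma> y)) \<le> C / (1 + y\<^sup>2)" for y
    using C[of "Complex \<sigma> y"] assms by simp
  have C0: "C \<ge> 0" using order_trans[OF norm_ge_zero bd[of 0]] by simp
  show ?thesis
  proof (intro exI[of _ "C * pi"] conjI[of "C * pi \<ge> 0"] allI impI)
    fix q :: "real \<Rightarrow> complex" and K
    assume q: "continuous_on UNIV q" "\<forall>y. norm (q y) \<le> K"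
    have "continuous_on UNIV (\<lambda>y. H (Complex \<sigma> y) * q y)"
      using line_continuous assms q(1) by (intro continuous_on_mult) auto
    moreover have "norm (H (Complex \<sigma> y) * q y) \<le> (C * K) / (1 + y\<^sup>2)" for y
      using mult_mono[OF bd[of y] q(2)[rule_format, of y]] C0 by (simp add: norm_mult)
    ultimately show "integrable lborel (\<lambda>y. H (Complex \<sigma> y) * q y) \<and>
       norm (LINT y|lborel. H (Complex \<sigma> y) * q y) \<le> C * pi * K"
      using integrable_quadratic_decay[of "\<lambda>y. H (Complex \<sigma> y) * q y" "C * K"] by (simp add: mult_ac)
  qed (use C0 in auto)
qed

lemma dist_line: "norm (Complex \<sigma> y - w) \<ge> \<bar>\<sigma> - Re w\<bar>"
  using abs_Re_le_cmod[of "Complex \<sigma> y - w"] by simp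

lemma kernel:
  assumes "Re w \<noteq> \<sigma>"
  shows "continuous_on UNIV (\<lambda>y. 1 / (Complex \<sigma> y - w))"
    and "norm (1 / (Complex \<sigma> y - w)) \<le> 1 / \<bar>\<sigma> - Re w\<bar>"
proof -
  have "Complex \<sigma> y \<noteq> w" for y using assms by (auto simp: complex_eq_iff)
  then show "continuous_on UNIV (\<lambda>y. 1 / (Complex \<sigma> y - w))"
    by (auto simp: Complex_eq intro!: continuous_intros)
  show "norm (1 / (Complex \<sigma> y - w)) \<le> 1 / \<bar>\<sigma> - Re w\<bar>"
    using dist_line assms by (auto simp: norm_divide intro!: divide_left_mono mult_pos_pos
        less_le_trans[OF _ dist_line])
qed

lemma vertical_cauchy_integral_bound:
  assumes "\<sigma> \<ge> 1"
  obtains C where "\<And>w. \<bar>\<sigma> - Re w\<bar> \<ge> 1 \<Longrightarrow> norm (vertical_cauchy_integral H \<sigma> w) \<le> C"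
proof -
  obtain C where C: "C \<ge> 0"
    "\<And>q K. \<lbrakk>continuous_on UNIV q; \<And>y. norm (q y) \<le> K\<rbrakk> \<Longrightarrow>
       norm (LINT y|lborel. H (Complex \<sigma> y) * q y) \<le> C * K"
    using line_integral_weighted_bound[OF assms] by blast
  show ?thesis
  proof (rule that[of "C / (2 * pi)"])
    fix w assume w: "\<bar>\<sigma> - Re w\<bar> \<ge> 1"
    then have ne: "Re w \<noteq> \<sigma>" by auto
    have "norm (1 / (Complex \<sigma> y - w)) \<le> 1" for y
      using kernel(2)[OF ne, of y] w by (smt (verit) divide_le_eq_1)
    then have "norm (LINT y|lborel. H (Complex \<sigma> y) * (1 / (Complex \<sigma> y - w))) \<le> C * 1"
      by (intro C(2) kernel(1) ne)
    then show "norm (vertical_cauchy_integral H \<sigma> w) \<le> C / (2 * pi)"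
      by (simp add: vertical_cauchy_integral_def norm_divide divide_right_mono)
  qed
qed

text \<open>
  Instead of differentiating under the integral, one integrates the exact second-order remainder of the Cauchy kernel,
  which is a product of three bounded kernels times \<open>(w - w\<^sub>0)\<^sup>2\<close>.
\<close>

lemma vertical_cauchy_integral_field_differentiable:
  assumes "\<sigma> \<ge> 1" and "Re w0 \<noteq> \<sigma>"
  shows "vertical_cauchy_integral H \<sigma> field_differentiable (at w0)"
proof -
  obtain C where C: "C \<ge> 0"
    "\<And>q K. \<lbrakk>continuous_on UNIV q; \<And>y. norm (q y) \<le> K\<rbrakk> \<Longrightarrow>
       integrable lborel (\<lambda>y. H (Complex \<sigma> y) * q y) \<and>
       norm (LINT y|lborel. H (Complex \<sigma> y) * q y) \<le> C * K"
    using line_integral_weighted_bound[OF assms(1)] by blast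
  define d where "d = \<bar>\<sigma> - Re w0\<bar>"
  have "d > 0" using assms(2) by (simp add: d_def)
  define k where "k = (\<lambda>w y. 1 / (Complex \<sigma> y - w))"
  define J where "J = (\<lambda>q. LINT y|lborel. H (Complex \<sigma> y) * q y)"
  have near: "\<bar>\<sigma> - Re w\<bar> \<ge> d / 2" if "norm (w - w0) < d / 2" for w
    using abs_Re_le_cmod[of "w - w0"] abs_triangle_ineq[of "\<sigma> - Re w" "Re w - Re w0"] that
    by (simp add: d_def)
  have k: "continuous_on UNIV (k w)" "\<And>y. norm (k w y) \<le> 2 / d" if "norm (w - w0) < d / 2" for w
  proof -
    have ne: "Re w \<noteq> \<sigma>" using near[OF that] \<open>d > 0\<close> by auto
    show "continuous_on UNIV (k w)" unfolding k_def by (rule kernel(1)[OF ne])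
    have "1 / \<bar>\<sigma> - Re w\<bar> \<le> 1 / (d / 2)"
      using near[OF that] \<open>d > 0\<close> by (intro divide_left_mono mult_pos_pos) auto
    then show "norm (k w y) \<le> 2 / d" for y
      using kernel(2)[OF ne, of y] unfolding k_def by simp
  qed
  have k0: "continuous_on UNIV (k w0)" "\<And>y. norm (k w0 y) \<le> 2 / d"
    using k[of w0] \<open>d > 0\<close> by auto
  have k0sq: "norm (k w0 y * k w0 y) \<le> 2 / d * (2 / d)" for y
    using mult_mono[OF k0(2)[of y] k0(2)[of y]] \<open>d > 0\<close> by (simp add: norm_mult)
  \<comment> \<open>The second difference of the Cauchy kernel is again a product of kernels.\<close>
  have expand: "J (k w) - J (k w0) - (w - w0) * J (\<lambda>y. k w0 y * k w0 y) =
      (w - w0)\<^sup>2 * J (\<lambda>y. k w y * (k w0 y * k w0 y))"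
    and third: "norm (J (\<lambda>y. k w y * (k w0 y * k w0 y))) \<le> C * (2 / d * (2 / d * (2 / d)))"
    if w: "norm (w - w0) < d / 2" for w
  proof -
    have ne: "Complex \<sigma> y \<noteq> w" "Complex \<sigma> y \<noteq> w0" for y
      using near[OF w] \<open>d > 0\<close> assms(2) by (auto simp: complex_eq_iff)
    have kk: "norm (k w y * (k w0 y * k w0 y)) \<le> 2 / d * (2 / d * (2 / d))" for y
      using mult_mono[OF k(2)[OF w, of y] k0sq[of y]] \<open>d > 0\<close> by (simp add: norm_mult)
    have c3: "continuous_on UNIV (\<lambda>y. k w y * (k w0 y * k w0 y))"
      using k(1)[OF w] k0(1) by (intro continuous_on_mult)
    have c2: "continuous_on UNIV (\<lambda>y. k w0 y * k w0 y)"
      using k0(1) by (intro continuous_on_mult)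
    note I = C(2)[OF k(1)[OF w] k(2)[OF w], THEN conjunct1] C(2)[OF k0, THEN conjunct1]
      C(2)[OF c2 k0sq, THEN conjunct1] C(2)[OF c3 kk, THEN conjunct1]
    have "J (k w) - J (k w0) - (w - w0) * J (\<lambda>y. k w0 y * k w0 y) =
       (LINT y|lborel. H (Complex \<sigma> y) * k w y - H (Complex \<sigma> y) * k w0 y
           - (w - w0) * (H (Complex \<sigma> y) * (k w0 y * k w0 y)))"
      using I by (simp add: J_def)
    also have "\<dots> = (LINT y|lborel. (w - w0)\<^sup>2 * (H (Complex \<sigma> y) * (k w y * (k w0 y * k w0 y))))"
    proof (rule Bochner_Integration.integral_cong)
      fix y
      have "k w y - k w0 y - (w - w0) * (k w0 y * k w0 y) = (w - w0)\<^sup>2 * (k w y * (k w0 y * k w0 y))"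
        using ne[of y] by (simp add: k_def divide_simps power2_eq_square) (simp add: algebra_simps)
      then show "H (Complex \<sigma> y) * k w y - H (Complex \<sigma> y) * k w0 y
           - (w - w0) * (H (Complex \<sigma> y) * (k w0 y * k w0 y)) =
          (w - w0)\<^sup>2 * (H (Complex \<sigma> y) * (k w y * (k w0 y * k w0 y)))"
        by algebra
    qed simp
    also have "\<dots> = (w - w0)\<^sup>2 * J (\<lambda>y. k w y * (k w0 y * k w0 y))"
      by (simp add: J_def)
    finally show "J (k w) - J (k w0) - (w - w0) * J (\<lambda>y. k w0 y * k w0 y) =
      (w - w0)\<^sup>2 * J (\<lambda>y. k w y * (k w0 y * k w0 y))" .
    show "norm (J (\<lambda>y. k w y * (k w0 y * k w0 y))) \<le> C * (2 / d * (2 / d * (2 / d)))"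
      unfolding J_def using C(2)[OF c3 kk] by blast
  qed
  have "((\<lambda>w. (J (k w) - J (k w0)) / (w - w0) - J (\<lambda>y. k w0 y * k w0 y)) \<longlongrightarrow> 0) (at w0)"
  proof (rule Lim_null_comparison)
    show "\<forall>\<^sub>F w in at w0. norm ((J (k w) - J (k w0)) / (w - w0) - J (\<lambda>y. k w0 y * k w0 y))
        \<le> norm (w - w0) * (C * (2 / d * (2 / d * (2 / d))))"
      unfolding eventually_at
    proof (intro exI[of _ "d / 2"] conjI ballI impI)
      fix w assume "w \<noteq> w0 \<and> dist w w0 < d / 2"
      then have w: "w \<noteq> w0" "norm (w - w0) < d / 2" by (auto simp: dist_norm)
      have "(J (k w) - J (k w0)) / (w - w0) - J (\<lambda>y. k w0 y * k w0 y) =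
          (J (k w) - J (k w0) - (w - w0) * J (\<lambda>y. k w0 y * k w0 y)) / (w - w0)"
        using w(1) by (simp add: field_simps)
      also have "\<dots> = (w - w0) * J (\<lambda>y. k w y * (k w0 y * k w0 y))"
        using w(1) by (simp add: expand[OF w(2)] power2_eq_square)
      finally have eq: "(J (k w) - J (k w0)) / (w - w0) - J (\<lambda>y. k w0 y * k w0 y) =
          (w - w0) * J (\<lambda>y. k w y * (k w0 y * k w0 y))" .
      show "norm ((J (k w) - J (k w0)) / (w - w0) - J (\<lambda>y. k w0 y * k w0 y))
        \<le> norm (w - w0) * (C * (2 / d * (2 / d * (2 / d))))"
        unfolding eq norm_mult by (intro mult_left_mono third w(2) norm_ge_zero)
    qed (use \<open>d > 0\<close> in simp)
    have "((\<lambda>w. norm (w - w0) * (C * (2 / d * (2 / d * (2 / d))))) \<longlongrightarrow>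
        norm (w0 - w0) * (C * (2 / d * (2 / d * (2 / d))))) (at w0)"
      by (intro tendsto_intros)
    then show "((\<lambda>w. norm (w - w0) * (C * (2 / d * (2 / d * (2 / d))))) \<longlongrightarrow> 0) (at w0)" by simp
  qed
  then have "((\<lambda>w. J (k w)) has_field_derivative J (\<lambda>y. k w0 y * k w0 y)) (at w0)"
    unfolding has_field_derivative_iff using Lim_null by blast
  moreover have "vertical_cauchy_integral H \<sigma> = (\<lambda>w. J (k w) / (2 * pi))"
    by (simp add: fun_eq_iff vertical_cauchy_integral_def J_def k_def)
  ultimately show ?thesis
    by (auto simp: field_differentiable_def intro!: exI DERIV_cdivide)
qed

lemma rectangle_integral:
  assumes "0 < \<sigma>" "\<sigma> < \<sigma>'" "Re w < \<sigma> \<or> \<sigma> < Re w \<and> Re w < \<sigma>'" "\<bar>Im w\<bar> < T"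
  shows "((\<lambda>t. H t / (t - w)) has_contour_integral (if Re w < \<sigma> then 0 else 2 * pi * \<i> * H w))
     (rectpath (Complex \<sigma> (-T)) (Complex \<sigma>' T))"
proof -
  have cbox: "path_image (rectpath (Complex \<sigma> (-T)) (Complex \<sigma>' T)) =
      cbox (Complex \<sigma> (-T)) (Complex \<sigma>' T) - box (Complex \<sigma> (-T)) (Complex \<sigma>' T)"
    using assms by (intro path_image_rectpath_cbox_minus_box) auto
  show ?thesis
  proof (cases "Re w < \<sigma>")
    case True
    define m where "m = max 0 (Re w)"
    have "(\<lambda>t. H t / (t - w)) holomorphic_on {t. Re t > m}"
      by (intro holomorphic_intros holomorphic_on_subset[OF hol]) (auto simp: m_def)
    moreover have "path_image (rectpath (Complex \<sigma> (-T)) (Complex \<sigma>' T)) \<subseteq> {t. Re t > m}"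
      unfolding cbox using assms True by (auto simp: m_def in_cbox_complex_iff)
    ultimately show ?thesis
      using True by (simp, intro Cauchy_theorem_convex_simple[of _ "{t. Re t > m}"])
        (auto simp: convex_halfspace_Re_gt)
  next
    case False
    then have w: "\<sigma> < Re w" "Re w < \<sigma>'" using assms by auto
    then have box: "w \<in> box (Complex \<sigma> (-T)) (Complex \<sigma>' T)"
      using assms by (auto simp: in_box_complex_iff)
    have "open {t. Re t > 0}" by (rule open_halfspace_Re_gt)
    then have "((\<lambda>t. H t / (t - w)) has_contour_integral
       (2 * pi * \<i> * winding_number (rectpath (Complex \<sigma> (-T)) (Complex \<sigma>' T)) w * H w))
       (rectpath (Complex \<sigma> (-T)) (Complex \<sigma>' T))"
      using assms w box unfolding cbox[symmetric]
      by (intro Cauchy_integral_formula_convex_simple[of "{t. Re t > 0}"] hol)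
        (auto simp: convex_halfspace_Re_gt interior_open cbox in_cbox_complex_iff)
    then show ?thesis using False winding_number_rectpath[OF box] by simp
  qed
qed

text \<open>
  Cauchy's theorem on the rectangle between the lines, cut off at height \<open>\<plusminus>n\<close>: the horizontal sides vanish in the limit.
  The pole at \<open>w\<close> contributes \<open>H(w)\<close> precisely when \<open>w\<close> lies between the lines.
\<close>

lemma vertical_cauchy_integral_shift:
  assumes "1 \<le> \<sigma>" "\<sigma> < \<sigma>'" "Re w < \<sigma> \<or> \<sigma> < Re w \<and> Re w < \<sigma>'"
  shows "vertical_cauchy_integral H \<sigma>' w =
    vertical_cauchy_integral H \<sigma> w + (if Re w < \<sigma> then 0 else H w)"
proof -
  define G where "G = (\<lambda>t. H t / (t - w))"
  define I where "I = (if Re w < \<sigma> then 0 else 2 * pi * \<i> * H w)"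
  obtain C where C: "\<And>t. \<lbrakk>1 \<le> Re t; Re t \<le> \<sigma>'\<rbrakk> \<Longrightarrow> norm (H t) \<le> C / (1 + (Im t)\<^sup>2)"
    using decay by blast
  have C0: "C \<ge> 0"
    using order_trans[OF norm_ge_zero C[of 1]] assms by simp
  have contG: "continuous_on A G" if "A \<subseteq> {t. Re t > 0} - {w}" for A
    unfolding G_def using that
    by (intro continuous_intros continuous_on_subset[OF holomorphic_on_imp_continuous_on[OF hol]]) auto
  define bot where "bot = (\<lambda>n::nat. contour_integral (linepath (Complex \<sigma> (- real n)) (Complex \<sigma>' (- real n))) G)"
  define top where "top = (\<lambda>n::nat. contour_integral (linepath (Complex \<sigma>' (real n)) (Complex \<sigma> (real n))) G)"
  define V where "V = (\<lambda>s (n::nat). integral {- real n..real n} (\<lambda>y. G (Complex s y)))"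
  have seg: "Re t \<ge> 1 \<and> Re t \<le> \<sigma>' \<and> Im t = y" if "t \<in> closed_segment (Complex \<sigma> y) (Complex \<sigma>' y)" for t y
  proof -
    have "t \<in> cbox (Complex \<sigma> y) (Complex \<sigma>' y)"
      using that assms(2) by (auto simp: closed_segment_same_Im closed_segment_eq_real_ivl in_cbox_complex_iff)
    then show ?thesis using assms(1) by (auto simp: in_cbox_complex_iff)
  qed
  have seg': "Re t = s \<and> s > 0" if "t \<in> closed_segment (Complex s x) (Complex s y)" "s = \<sigma> \<or> s = \<sigma>'" for s t x y
    using that assms by (auto simp: closed_segment_same_Re)
  have ne: "Re w \<noteq> \<sigma>" "Re w \<noteq> \<sigma>'" using assms by auto
  have horizontal: "G contour_integrable_on (linepath (Complex \<sigma> y) (Complex \<sigma>' y))"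
     "norm (contour_integral (linepath (Complex \<sigma> y) (Complex \<sigma>' y)) G) \<le> C / (\<bar>y\<bar> - \<bar>Im w\<bar>) * (\<sigma>' - \<sigma>)"
    if y: "\<bar>y\<bar> > \<bar>Im w\<bar>" for y
  proof -
    have "continuous_on (closed_segment (Complex \<sigma> y) (Complex \<sigma>' y)) G"
      using seg[of _ y] y by (intro contG) fastforce
    then show int: "G contour_integrable_on (linepath (Complex \<sigma> y) (Complex \<sigma>' y))"
      by (rule contour_integrable_continuous_linepath)
    have "norm (G t) \<le> C / (\<bar>y\<bar> - \<bar>Im w\<bar>)" if "t \<in> closed_segment (Complex \<sigma> y) (Complex \<sigma>' y)" for t
    proof -
      have t: "1 \<le> Re t" "Re t \<le> \<sigma>'" "Im t = y" using seg[OF that] by auto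
      have "norm (H t) \<le> C / (1 + y\<^sup>2)" using C t by auto
      also have "\<dots> \<le> C / 1" using C0 by (intro divide_left_mono) (auto intro: add_pos_nonneg)
      finally have "norm (H t) \<le> C" by simp
      moreover have "norm (t - w) \<ge> \<bar>y\<bar> - \<bar>Im w\<bar>"
        using abs_Im_le_cmod[of "t - w"] t(3) by simp
      ultimately show ?thesis
        using y C0 by (auto simp: G_def norm_divide intro!: frac_le)
    qed
    then have "norm (contour_integral (linepath (Complex \<sigma> y) (Complex \<sigma>' y)) G)
        \<le> C / (\<bar>y\<bar> - \<bar>Im w\<bar>) * norm (Complex \<sigma>' y - Complex \<sigma> y)"
      using y C0 by (intro contour_integral_bound_linepath int) auto
    then show "norm (contour_integral (linepath (Complex \<sigma> y) (Complex \<sigma>' y)) G) \<le> C / (\<bar>y\<bar> - \<bar>Im w\<bar>) * (\<sigma>' - \<sigma>)"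
      using assms(2) by (simp add: cmod_def)
  qed
  have top_reverse: "G contour_integrable_on (linepath (Complex \<sigma>' (real n)) (Complex \<sigma> (real n)))"
     "norm (top n) \<le> C / (real n - \<bar>Im w\<bar>) * (\<sigma>' - \<sigma>)" if "real n > \<bar>Im w\<bar>" for n
  proof -
    have cont: "continuous_on (closed_segment (Complex \<sigma>' (real n)) (Complex \<sigma> (real n))) G"
      using seg[of _ "real n"] that unfolding closed_segment_commute[of "Complex \<sigma>' _"]
      by (intro contG) fastforce
    then show "G contour_integrable_on (linepath (Complex \<sigma>' (real n)) (Complex \<sigma> (real n)))"
      by (rule contour_integrable_continuous_linepath)
    show "norm (top n) \<le> C / (real n - \<bar>Im w\<bar>) * (\<sigma>' - \<sigma>)"
      unfolding top_def contour_integral_reverse_linepath[OF cont]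
      using horizontal(2)[of "real n"] that by simp
  qed
  have bot_bound: "norm (bot n) \<le> C / (real n - \<bar>Im w\<bar>) * (\<sigma>' - \<sigma>)" if "real n > \<bar>Im w\<bar>" for n
    using horizontal(2)[of "- real n"] that by (simp add: bot_def)
  have vertical: "G contour_integrable_on (linepath (Complex s x) (Complex s y))" if "s = \<sigma> \<or> s = \<sigma>'" for s x y
    using seg'[OF _ that] ne that by (intro contour_integrable_continuous_linepath contG) fastforce
  have sum: "bot n + \<i> * V \<sigma>' n + top n - \<i> * V \<sigma> n = I" if n: "real n > \<bar>Im w\<bar>" for n
  proof -
    have n0: "real n > 0" using n by linarith
    have up: "contour_integral (linepath (Complex \<sigma>' (- real n)) (Complex \<sigma>' (real n))) G = \<i> * V \<sigma>' n"
      unfolding V_def using n0 by (intro contour_integral_linepath_same_Re) auto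
    have "continuous_on (closed_segment (Complex \<sigma> (real n)) (Complex \<sigma> (- real n))) G"
      using seg'[of _ \<sigma>] ne by (intro contG) fastforce
    then have "contour_integral (linepath (Complex \<sigma> (real n)) (Complex \<sigma> (- real n))) G =
       - contour_integral (linepath (Complex \<sigma> (- real n)) (Complex \<sigma> (real n))) G"
      by (rule contour_integral_reverse_linepath)
    also have "contour_integral (linepath (Complex \<sigma> (- real n)) (Complex \<sigma> (real n))) G = \<i> * V \<sigma> n"
      unfolding V_def using n0 by (intro contour_integral_linepath_same_Re) auto
    finally have down: "contour_integral (linepath (Complex \<sigma> (real n)) (Complex \<sigma> (- real n))) G = - (\<i> * V \<sigma> n)" .
    have "contour_integral (rectpath (Complex \<sigma> (- real n)) (Complex \<sigma>' (real n))) G = I"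
      unfolding G_def I_def
      by (intro contour_integral_unique rectangle_integral) (use assms n in auto)
    also have "contour_integral (rectpath (Complex \<sigma> (- real n)) (Complex \<sigma>' (real n))) G =
        bot n + (\<i> * V \<sigma>' n + (top n - \<i> * V \<sigma> n))"
      using vertical top_reverse(1)[OF n] horizontal(1)[of "- real n"] n
      by (simp add: rectpath_def Let_def up down bot_def top_def)
    finally show ?thesis by (simp add: algebra_simps)
  qed
  have bound_0: "(\<lambda>n. C / (real n - \<bar>Im w\<bar>) * (\<sigma>' - \<sigma>)) \<longlonglongrightarrow> 0"
    by real_asymp
  have ev: "\<forall>\<^sub>F n in sequentially. real n > \<bar>Im w\<bar>"
    by real_asymp
  have "bot \<longlonglongrightarrow> 0" "top \<longlonglongrightarrow> 0"
    by (rule Lim_null_comparison[OF _ bound_0], use ev bot_bound top_reverse in \<open>auto elim: eventually_mono\<close>)+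
  have V: "V s \<longlonglongrightarrow> 2 * pi * vertical_cauchy_integral H s w" if s: "s = \<sigma> \<or> s = \<sigma>'" for s
  proof -
    have ne': "Re w \<noteq> s" using s ne by auto
    have "s \<ge> 1" using s assms by auto
    then obtain C' where "\<And>q K. \<lbrakk>continuous_on UNIV q; \<And>y. norm (q y) \<le> K\<rbrakk> \<Longrightarrow>
       integrable lborel (\<lambda>y. H (Complex s y) * q y)"
      using line_integral_weighted_bound[of s] by blast
    from this[OF kernel(1,2)[OF ne']] have "integrable lborel (\<lambda>y. G (Complex s y))"
      by (simp add: G_def)
    from integral_symmetric_interval_tendsto[OF this] show ?thesis
      by (simp add: V_def vertical_cauchy_integral_def G_def)
  qed
  have "(\<lambda>n. bot n + \<i> * V \<sigma>' n + top n - \<i> * V \<sigma> n) \<longlonglongrightarrow>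
      0 + \<i> * (2 * pi * vertical_cauchy_integral H \<sigma>' w) + 0 - \<i> * (2 * pi * vertical_cauchy_integral H \<sigma> w)"
    using V \<open>bot \<longlonglongrightarrow> 0\<close> \<open>top \<longlonglongrightarrow> 0\<close> by (intro tendsto_intros) auto
  moreover have "(\<lambda>n. bot n + \<i> * V \<sigma>' n + top n - \<i> * V \<sigma> n) \<longlonglongrightarrow> I"
    using ev sum by (intro tendsto_eventually) (auto elim: eventually_mono)
  ultimately have "\<i> * (2 * pi * vertical_cauchy_integral H \<sigma>' w) - \<i> * (2 * pi * vertical_cauchy_integral H \<sigma> w) = I"
    using LIMSEQ_unique by fastforce
  then have "(2 * pi * \<i>) * vertical_cauchy_integral H \<sigma>' w =
     (2 * pi * \<i>) * (vertical_cauchy_integral H \<sigma> w + (if Re w < \<sigma> then 0 else H w))"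
    by (auto simp: I_def algebra_simps)
  then show ?thesis by simp
qed

text \<open>
  Near the line of integration the Cauchy integral is not obviously bounded, so lines at distance at least one from
  \<open>w\<close> are used: \<open>\<sigma> = 4\<close> for \<open>Re w \<le> 3\<close> and \<open>\<sigma> = 1\<close> for
  \<open>Re w \<ge> 2\<close>. The overlap of the two half planes leaves room for Cauchy's estimates for the derivatives.
\<close>

theorem entire_approximation:
  obtains f M where "f holomorphic_on UNIV"
    and "\<And>w. Re w \<le> 3 \<Longrightarrow> norm (f w) \<le> M"
    and "\<And>w. Re w \<ge> 2 \<Longrightarrow> norm (f w - H w) \<le> M"
proof -
  \<comment> \<open>Any line to the right of \<open>w\<close> gives the same value.\<close>
  define f where "f = (\<lambda>w. vertical_cauchy_integral H (max 1 (Re w) + 1) w)"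
  have f_eq: "f w = vertical_cauchy_integral H \<sigma> w" if "\<sigma> \<ge> 1" "Re w < \<sigma>" for w \<sigma>
  proof -
    define m where "m = max 1 (Re w) + 1"
    have "m \<ge> 1" "Re w < m" by (auto simp: m_def)
    consider "m < \<sigma>" | "m = \<sigma>" | "\<sigma> < m" by linarith
    then have "vertical_cauchy_integral H m w = vertical_cauchy_integral H \<sigma> w"
    proof cases
      case 1
      from vertical_cauchy_integral_shift[OF \<open>m \<ge> 1\<close> this, of w] \<open>Re w < m\<close> show ?thesis by simp
    next
      case 3
      from vertical_cauchy_integral_shift[OF \<open>\<sigma> \<ge> 1\<close> this, of w] \<open>Re w < \<sigma>\<close> show ?thesis by simp
    qed simp
    then show ?thesis by (simp add: f_def m_def)
  qed
  obtain C1 where C1: "\<And>w. \<bar>1 - Re w\<bar> \<ge> 1 \<Longrightarrow> norm (vertical_cauchy_integral H 1 w) \<le> C1"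
    using vertical_cauchy_integral_bound[of 1] by auto
  obtain C4 where C4: "\<And>w. \<bar>4 - Re w\<bar> \<ge> 1 \<Longrightarrow> norm (vertical_cauchy_integral H 4 w) \<le> C4"
    using vertical_cauchy_integral_bound[of 4] by auto
  show ?thesis
  proof (rule that[of f "max C1 C4"])
    have "f field_differentiable (at w)" for w
    proof -
      define \<sigma> where "\<sigma> = max 1 (Re w) + 1"
      have \<sigma>: "\<sigma> \<ge> 1" "Re w < \<sigma>" by (auto simp: \<sigma>_def)
      have "vertical_cauchy_integral H \<sigma> field_differentiable (at w)"
        using \<sigma> by (intro vertical_cauchy_integral_field_differentiable) auto
      moreover have "\<forall>\<^sub>F v in nhds w. vertical_cauchy_integral H \<sigma> v = f v"
        using eventually_nhds_in_open[OF open_halfspace_Re_lt, of w \<sigma>] \<sigma> f_eq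
        by (auto elim!: eventually_mono)
      ultimately show ?thesis
        unfolding field_differentiable_def using DERIV_cong_ev by blast
    qed
    then show "f holomorphic_on UNIV"
      by (simp add: holomorphic_on_def field_differentiable_at_within)
    show "norm (f w) \<le> max C1 C4" if "Re w \<le> 3" for w
      using that f_eq[of 4 w] C4[of w] by (auto simp: le_max_iff_disj)
    show "norm (f w - H w) \<le> max C1 C4" if "Re w \<ge> 2" for w
    proof -
      have "f w = vertical_cauchy_integral H 1 w + H w"
        using that vertical_cauchy_integral_shift[of 1 "Re w + 1" w] f_eq[of "Re w + 1" w] by simp
      then show ?thesis using C1[of w] that by (auto simp: le_max_iff_disj)
    qed
  qed
qed

end

section \<open>The exponential of a power in a half plane\<close>

lemma norm_powr_of_real:
  fixes z :: complex
  assumes "z \<noteq> 0"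
  shows "norm (z powr of_real s) = norm z powr s"
  using assms by (simp add: powr_def norm_exp_eq_Re)

text \<open>
  At \<open>\<plusminus>\<i>\<close> the power has argument \<open>\<plusminus>\<pi>s/2\<close>, which lies in the open left half plane because \<open>1 < s < 2\<close>;
  continuity extends this to a neighbourhood.
\<close>

lemma Re_powr_near_imaginary_unit:
  fixes \<epsilon> :: complex
  assumes "1 < s" "s < 2" "\<epsilon> = \<i> \<or> \<epsilon> = - \<i>"
  shows "\<exists>\<delta>>0. \<forall>w. dist w \<epsilon> < \<delta> \<longrightarrow> Re (w powr of_real s) < cos (pi * s / 2) / 2"
proof -
  have "cos (pi * s / 2) < 0"
    using assms by (intro cos_lt_zero_pi) (auto simp: field_simps)
  moreover have "Re (\<epsilon> powr of_real s) = cos (pi * s / 2)"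
    using assms(3) by (auto simp: powr_def Re_exp algebra_simps)
  ultimately have lt: "Re (\<epsilon> powr of_real s) < cos (pi * s / 2) / 2" by simp
  have "isCont (\<lambda>w. w powr of_real s) \<epsilon>"
    using assms(3) by (intro DERIV_isCont[OF has_field_derivative_powr]) (auto simp: complex_nonpos_Reals_iff)
  then have "isCont (\<lambda>w. Re (w powr of_real s)) \<epsilon>"
    by (rule continuous_Re)
  then have "((\<lambda>w. Re (w powr of_real s)) \<longlongrightarrow> Re (\<epsilon> powr of_real s)) (nhds \<epsilon>)"
    using tendsto_at_iff_tendsto_nhds[of "\<lambda>w. Re (w powr of_real s)" \<epsilon>] by (simp add: isCont_def)
  from order_tendstoD(2)[OF this lt] show ?thesis
    by (auto simp: eventually_nhds_metric)
qed

text \<open>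
  Far out in the strip, \<open>t / \<bar>Im t\<bar>\<close> is close to \<open>\<plusminus>\<i>\<close>, so \<open>Re (t powr s)\<close> is at most a negative multiple of
  \<open>\<bar>Im t\<bar> powr s\<close> and the exponential decays faster than any power. The rest of the strip is bounded.
\<close>

lemma exp_powr_strip_decay:
  fixes s b :: real
  assumes "1 < s" "s < 2"
  shows "\<exists>C. \<forall>t. 1 \<le> Re t \<and> Re t \<le> b \<longrightarrow> norm (exp (t powr of_real s)) \<le> C / (1 + (Im t)\<^sup>2)"
proof -
  define \<kappa> where "\<kappa> = - (cos (pi * s / 2) / 2)"
  have "cos (pi * s / 2) < 0"
    using assms by (intro cos_lt_zero_pi) (auto simp: field_simps)
  then have "\<kappa> > 0" by (simp add: \<kappa>_def)
  obtain \<delta>1 \<delta>2 where \<delta>12: "\<delta>1 > 0" "\<delta>2 > 0"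
    "\<And>w. dist w \<i> < \<delta>1 \<Longrightarrow> Re (w powr of_real s) < - \<kappa>"
    "\<And>w. dist w (- \<i>) < \<delta>2 \<Longrightarrow> Re (w powr of_real s) < - \<kappa>"
    using Re_powr_near_imaginary_unit[OF assms, of \<i>] Re_powr_near_imaginary_unit[OF assms, of "- \<i>"]
    unfolding \<kappa>_def by auto
  define \<delta> where "\<delta> = min \<delta>1 \<delta>2"
  have \<delta>: "\<delta> > 0" "\<And>w \<epsilon>. \<lbrakk>\<epsilon> = \<i> \<or> \<epsilon> = - \<i>; dist w \<epsilon> < \<delta>\<rbrakk> \<Longrightarrow> Re (w powr of_real s) < - \<kappa>"
    using \<delta>12 by (auto simp: \<delta>_def)
  define Y where "Y = max 1 (\<bar>b\<bar> / \<delta>)"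
  define B where "B = exp ((\<bar>b\<bar> + Y) powr s)"
  have far: "norm (exp (t powr of_real s)) \<le> (1 + 2 / \<kappa>\<^sup>2) / (1 + (Im t)\<^sup>2)"
    if t: "1 \<le> Re t" "Re t \<le> b" "\<bar>Im t\<bar> > Y" for t
  proof -
    define y where "y = \<bar>Im t\<bar>"
    have y: "y > 1" "y > \<bar>b\<bar> / \<delta>" using t by (auto simp: y_def Y_def)
    define \<epsilon> where "\<epsilon> = of_real (sgn (Im t)) * \<i>"
    have \<epsilon>: "\<epsilon> = \<i> \<or> \<epsilon> = - \<i>" using y by (auto simp: \<epsilon>_def y_def sgn_if)
    define w where "w = t / of_real y"
    have tw: "t = of_real y * w" "w \<noteq> 0" using y t by (auto simp: w_def)
    have "t - of_real y * \<epsilon> = of_real (Re t)"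
      by (auto simp: complex_eq_iff \<epsilon>_def y_def abs_mult_sgn abs_sgn sgn_if)
    then have "w - \<epsilon> = of_real (Re t) / of_real y"
      using y by (simp add: w_def field_simps)
    then have "dist w \<epsilon> = Re t / y"
      using t y by (simp add: dist_norm norm_divide)
    also have "\<dots> < \<delta>"
      using y t \<delta>(1) by (simp add: field_simps)
    finally have Re_w: "Re (w powr of_real s) < - \<kappa>" using \<delta>(2) \<epsilon> by blast
    have "t powr of_real s = of_real (y powr s) * w powr of_real s"
      using tw y by (simp add: powr_def Ln_times_of_real Ln_of_real exp_add ring_distribs exp_of_real[symmetric])
    then have "Re (t powr of_real s) = y powr s * Re (w powr of_real s)" by simp
    also have "\<dots> \<le> y powr s * (- \<kappa>)" using Re_w by (intro mult_left_mono) auto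
    also have "\<dots> \<le> - (\<kappa> * y)"
      using powr_mono[of 1 s y] assms y \<open>\<kappa> > 0\<close> by simp
    finally have "norm (exp (t powr of_real s)) \<le> exp (- (\<kappa> * y))"
      by simp
    also have "\<dots> \<le> (1 + 2 / \<kappa>\<^sup>2) / (1 + y\<^sup>2)"
    proof -
      have q: "1 + \<kappa> * y + (\<kappa> * y)\<^sup>2 / 2 \<le> exp (\<kappa> * y)"
        using y \<open>\<kappa> > 0\<close> by (intro exp_lower_Taylor_quadratic) simp
      then have q2: "(\<kappa> * y)\<^sup>2 / 2 \<le> exp (\<kappa> * y)"
        using y \<open>\<kappa> > 0\<close> by (smt (verit) mult_pos_pos)
      have "y\<^sup>2 = 2 / \<kappa>\<^sup>2 * ((\<kappa> * y)\<^sup>2 / 2)"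
        using \<open>\<kappa> > 0\<close> by (simp add: power_mult_distrib)
      also have "\<dots> \<le> 2 / \<kappa>\<^sup>2 * exp (\<kappa> * y)"
        using q2 by (intro mult_left_mono) auto
      finally have "1 + y\<^sup>2 \<le> (1 + 2 / \<kappa>\<^sup>2) * exp (\<kappa> * y)"
        using y \<open>\<kappa> > 0\<close> by (simp add: ring_distribs add_mono)
      then show ?thesis
        by (simp add: exp_minus field_simps add_pos_nonneg)
    qed
    finally show ?thesis by (simp add: y_def)
  qed
  have near: "norm (exp (t powr of_real s)) \<le> B * (1 + Y\<^sup>2) / (1 + (Im t)\<^sup>2)"
    if t: "1 \<le> Re t" "Re t \<le> b" "\<bar>Im t\<bar> \<le> Y" for t
  proof -
    have "t \<noteq> 0" using t by auto
    have "norm t \<le> \<bar>b\<bar> + Y" using cmod_le[of t] t by linarith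
    then have "norm t powr s \<le> (\<bar>b\<bar> + Y) powr s" using assms by (intro powr_mono2) auto
    then have "norm (exp (t powr of_real s)) \<le> B"
      using norm_exp[of "t powr of_real s"] norm_powr_of_real[OF \<open>t \<noteq> 0\<close>, of s]
      by (auto simp: B_def intro: order_trans)
    moreover have "(Im t)\<^sup>2 \<le> Y\<^sup>2" using t(3) by (metis abs_le_square_iff abs_of_nonneg abs_ge_zero order_trans)
    ultimately have "norm (exp (t powr of_real s)) * (1 + (Im t)\<^sup>2) \<le> B * (1 + Y\<^sup>2)"
      by (intro mult_mono) (auto simp: B_def)
    then show ?thesis by (simp add: field_simps add_pos_nonneg)
  qed
  show ?thesis
  proof (intro exI[of _ "max (1 + 2 / \<kappa>\<^sup>2) (B * (1 + Y\<^sup>2))"] allI impI)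
    fix t assume t: "1 \<le> Re t \<and> Re t \<le> b"
    have "1 + (Im t)\<^sup>2 > 0" by (simp add: add_pos_nonneg)
    then show "norm (exp (t powr of_real s)) \<le> max (1 + 2 / \<kappa>\<^sup>2) (B * (1 + Y\<^sup>2)) / (1 + (Im t)\<^sup>2)"
      using near[of t] far[of t] t
      by (cases "\<bar>Im t\<bar> \<le> Y") (auto elim!: order_trans intro!: divide_right_mono)
  qed
qed

lemma holomorphic_on_exp_powr: "(\<lambda>t. exp (t powr of_real s)) holomorphic_on {t. Re t > 0}"
  by (intro holomorphic_intros) (auto simp: complex_nonpos_Reals_iff)

text \<open>
  Up to a bounded error, such a function has a single tract, in which it behaves like the exponential of a power. The two
  half planes overlap in the strip \<open>2 \<le> Re w \<le> 3\<close>, so around every point there is a disc of radius \<open>1/2\<close> on which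
  one of the two estimates holds throughout.
\<close>

locale tract_function =
  fixes s M :: real and f :: "complex \<Rightarrow> complex"
  assumes s: "1 \<le> s" "s < 2"
    and hol: "f holomorphic_on UNIV"
    and left: "\<And>w. Re w \<le> 3 \<Longrightarrow> norm (f w) \<le> M"
    and right: "\<And>w. Re w \<ge> 2 \<Longrightarrow> norm (f w - exp (w powr of_real s)) \<le> M"

lemma tract_function_exists:
  assumes "1 \<le> s" "s < 2"
  shows "\<exists>M f. tract_function s M f"
proof (cases "s = 1")
  case True
  have "tract_function 1 (exp 3) exp"
    by unfold_locales (auto simp: powr_def norm_exp_eq_Re intro: holomorphic_intros)
  then show ?thesis using True by blast
next
  case False
  interpret strip_decay "\<lambda>t. exp (t powr of_real s)"
    using False assms by unfold_locales (rule holomorphic_on_exp_powr exp_powr_strip_decay; simp)+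
  obtain f M where "f holomorphic_on UNIV" "\<And>w. Re w \<le> 3 \<Longrightarrow> norm (f w) \<le> M"
    "\<And>w. Re w \<ge> 2 \<Longrightarrow> norm (f w - exp (w powr of_real s)) \<le> M"
    using entire_approximation by blast
  then have "tract_function s M f" using assms by unfold_locales auto
  then show ?thesis by blast
qed

context tract_function
begin

lemma M_nonneg: "M \<ge> 0"
  using order_trans[OF norm_ge_zero left[of 0]] by simp

lemma deriv_bound_half_disc:
  assumes "g holomorphic_on ball w (3/4)" "\<And>v. norm (w - v) = 1/2 \<Longrightarrow> norm (g v) \<le> M"
  shows "norm (deriv g w) \<le> 2 * M"
proof -
  have "norm ((deriv ^^ 1) g w) \<le> fact 1 * M / (1/2) ^ 1"
    using assms by (intro Cauchy_inequality holomorphic_on_imp_continuous_on)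
      (auto elim!: holomorphic_on_subset)
  then show ?thesis by simp
qed

lemma deriv_left:
  assumes "Re w \<le> 5/2"
  shows "norm (deriv f w) \<le> 2 * M"
proof (rule deriv_bound_half_disc)
  show "norm (f v) \<le> M" if "norm (w - v) = 1/2" for v
    using abs_Re_le_cmod[of "w - v", unfolded minus_complex.sel abs_le_iff] that assms
    by (intro left) linarith
qed (rule holomorphic_on_subset[OF hol], simp)

lemma deriv_right:
  assumes "Re w \<ge> 5/2"
  shows "norm (deriv f w - of_real s * w powr of_real (s - 1) * exp (w powr of_real s)) \<le> 2 * M"
proof -
  define R where "R = (\<lambda>w. f w - exp (w powr of_real s))"
  have "R holomorphic_on {t. Re t > 0}"
    unfolding R_def by (intro holomorphic_intros holomorphic_on_exp_powr holomorphic_on_subset[OF hol]) auto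
  moreover have "Re v > 0" if "v \<in> ball w (3/4)" for v
    using abs_Re_le_cmod[of "w - v"] that assms by (auto simp: dist_norm)
  ultimately have "R holomorphic_on ball w (3/4)"
    by (elim holomorphic_on_subset) auto
  moreover have "norm (R v) \<le> M" if "norm (w - v) = 1/2" for v
    using abs_Re_le_cmod[of "w - v", unfolded minus_complex.sel abs_le_iff] that assms
    unfolding R_def by (intro right) linarith
  ultimately have "norm (deriv R w) \<le> 2 * M"
    by (rule deriv_bound_half_disc)
  moreover have "(R has_field_derivative
      (deriv f w - exp (w powr of_real s) * (of_real s * w powr (of_real s - 1)))) (at w)"
    unfolding R_def using assms hol
    by (intro DERIV_diff DERIV_fun_exp has_field_derivative_powr)
      (auto simp: complex_nonpos_Reals_iff holomorphic_derivI)
  ultimately show ?thesis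
    using DERIV_imp_deriv by (fastforce simp: algebra_simps)
qed

lemma norm_exp_powr_le:
  assumes "Re u \<ge> 5/2"
  shows "norm (exp (u powr of_real s)) \<le> norm (f u + f (- u)) + 2 * M"
proof -
  have "norm (f u - exp (u powr of_real s)) \<le> M" "norm (f (- u)) \<le> M"
    using assms by (auto intro: right left)
  then show ?thesis
    using norm_triangle_ineq4[of "f u + f (- u)" "(f u - exp (u powr of_real s)) + f (- u)"]
      norm_triangle_ineq[of "f u - exp (u powr of_real s)" "f (- u)"] by simp
qed

text \<open>
  The term \<open>f(- u)\<close> is a bounded perturbation for \<open>u\<close> in the right half plane; it appears on the right because the
  bound is needed in terms of the even part of \<open>f\<close>.
\<close>

lemma norm_deriv_le:
  assumes "norm u \<ge> 1"
  shows "norm (deriv f u) \<le> 2 * norm u powr (s - 1) * (norm (f u + f (- u)) + 2 * M) + 2 * M"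
proof (cases "Re u \<le> 5/2")
  case True
  then show ?thesis using deriv_left[OF True] M_nonneg by (auto intro: add_increasing)
next
  case False
  have "norm (u powr of_real (s - 1)) = norm u powr (s - 1)"
    using assms by (intro norm_powr_of_real) auto
  moreover have "norm u powr (s - 1) * norm (exp (u powr of_real s))
      \<le> norm u powr (s - 1) * (norm (f u + f (- u)) + 2 * M)"
    using norm_exp_powr_le[of u] False by (intro mult_left_mono) auto
  ultimately have "norm (of_real s * u powr of_real (s - 1) * exp (u powr of_real s))
      \<le> s * norm u powr (s - 1) * (norm (f u + f (- u)) + 2 * M)"
    using s by (simp only: norm_mult norm_of_real mult.assoc) (simp add: mult_left_mono)
  also have "\<dots> \<le> 2 * norm u powr (s - 1) * (norm (f u + f (- u)) + 2 * M)"
    using s M_nonneg by (intro mult_right_mono) auto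
  finally show ?thesis
    using norm_triangle_sub[of "deriv f u" "of_real s * u powr of_real (s - 1) * exp (u powr of_real s)"]
      deriv_right[of u] False by simp
qed

text \<open>
  The hypothesis says that \<open>u\<close> is a critical point of \<open>f(u) + f(- u)\<close>. Inside the tract the main term of \<open>f'(u)\<close>
  must then be balanced by bounded terms. As its power factor has modulus at least one, the exponential is bounded there.
\<close>

lemma norm_even_part_le_of_critical:
  assumes "Re u \<ge> 0" "deriv f u = deriv f (- u)"
  shows "norm (f u + f (- u)) \<le> 6 * M"
proof (cases "Re u \<le> 5/2")
  case True
  then have "norm (f u) \<le> M" "norm (f (- u)) \<le> M" using assms by (auto intro!: left)
  then show ?thesis using norm_triangle_ineq[of "f u" "f (- u)"] M_nonneg by linarith
next
  case False
  define E where "E = norm (exp (u powr of_real s))"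
  have u: "norm u \<ge> 1" using complex_Re_le_cmod[of u] False by linarith
  have "norm (deriv f u) \<le> 2 * M"
    unfolding assms(2) using False by (intro deriv_left) auto
  then have "norm (of_real s * u powr of_real (s - 1) * exp (u powr of_real s)) \<le> 4 * M"
    using norm_triangle_sub[of "of_real s * u powr of_real (s - 1) * exp (u powr of_real s)" "deriv f u"]
      deriv_right[of u] False by (simp add: norm_minus_commute)
  moreover have "norm (of_real s * u powr of_real (s - 1) * exp (u powr of_real s)) = s * norm u powr (s - 1) * E"
  proof -
    have "norm (u powr of_real (s - 1)) = norm u powr (s - 1)"
      using u by (intro norm_powr_of_real) auto
    then show ?thesis using s by (simp only: E_def norm_mult norm_of_real)
  qed
  moreover have "1 * E \<le> s * norm u powr (s - 1) * E"
    using s u mult_mono[of 1 s 1 "norm u powr (s - 1)"]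
    by (intro mult_right_mono) (auto simp: E_def ge_one_powr_ge_zero)
  ultimately have "E \<le> 4 * M" by linarith
  moreover have "norm (f u - exp (u powr of_real s)) \<le> M" "norm (f (- u)) \<le> M"
    using False by (auto intro: right left)
  moreover have "norm (f u + f (- u)) \<le> norm (f u - exp (u powr of_real s)) + E + norm (f (- u))"
    using norm_triangle_ineq[of "f u" "f (- u)"] norm_triangle_sub[of "f u" "exp (u powr of_real s)"]
    unfolding E_def by linarith
  ultimately show ?thesis by linarith
qed

end

section \<open>Auxiliary facts on growth, logarithms and even functions\<close>

lemma orders_eqI:
  fixes g :: "complex \<Rightarrow> complex"
  assumes "continuous_on UNIV g" "\<rho> > 0"
    and upper: "\<And>z. norm z \<ge> 1 \<Longrightarrow> norm (g z) \<le> exp (norm z powr \<rho>) + A"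
    and lower: "\<forall>\<^sub>F r in at_top. exp (r powr \<rho>) - A \<le> norm (g (of_real r))"
  shows "lower_growth_order g = ereal \<rho>" "growth_order g = ereal \<rho>"
proof -
  define m where "m = (\<lambda>r. max_modulus r g)"
  have m_le: "m r \<le> exp (r powr \<rho>) + A" if "r \<ge> 1" for r
    using max_modulus_attained[OF assms(1), of r] upper that by (auto simp: m_def)
  have m_ge: "norm (g (of_real r)) \<le> m r" if "r \<ge> 0" for r
    using max_modulus_attained[OF assms(1), of r] that by (auto simp: m_def)
  have powr_lim: "filterlim (\<lambda>r. r powr \<rho>) at_top at_top"
    using \<open>\<rho> > 0\<close> by real_asymp
  have "\<forall>\<^sub>F x in at_top. exp x + A \<le> exp (2 * x)" "\<forall>\<^sub>F x in at_top. exp (x / 2) \<le> exp x - A"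
    by real_asymp+
  then have ev: "\<forall>\<^sub>F r in at_top. exp (r powr \<rho>) + A \<le> exp (2 * r powr \<rho>)"
      "\<forall>\<^sub>F r in at_top. exp (r powr \<rho> / 2) \<le> exp (r powr \<rho>) - A"
    using eventually_compose_filterlim[OF _ powr_lim] by blast+
  have "\<forall>\<^sub>F r in at_top. (\<rho> * ln r - ln 2) / ln r \<le> ln (ln (m r)) / ln r \<and>
      ln (ln (m r)) / ln r \<le> (\<rho> * ln r + ln 2) / ln r"
    using ev lower eventually_gt_at_top[of 1]
  proof eventually_elim
    case (elim r)
    define x where "x = r powr \<rho>"
    have x: "x > 0" "ln x = \<rho> * ln r" using elim by (auto simp: x_def ln_powr)
    have "exp (x / 2) \<le> m r" "m r \<le> exp (2 * x)"
      using elim m_le[of r] m_ge[of r] by (auto simp: x_def)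
    moreover from this have "m r > 0" by (blast intro: less_le_trans[OF exp_gt_zero])
    ultimately have "x / 2 \<le> ln (m r)" "ln (m r) \<le> 2 * x"
      using ln_le_cancel_iff[of "m r" "exp (2 * x)"] ln_le_cancel_iff[of "exp (x / 2)" "m r"] by auto
    moreover from this have "ln (m r) > 0" using x by linarith
    ultimately have "ln (x / 2) \<le> ln (ln (m r))" "ln (ln (m r)) \<le> ln (2 * x)"
      using x by (auto simp del: ln_mult ln_div)
    then have "\<rho> * ln r - ln 2 \<le> ln (ln (m r))" "ln (ln (m r)) \<le> \<rho> * ln r + ln 2"
      using x by (auto simp: ln_div ln_mult)
    then show ?case using elim by (auto intro!: divide_right_mono)
  qed
  then have ev2: "\<forall>\<^sub>F r in at_top. (\<rho> * ln r - ln 2) / ln r \<le> ln (ln (m r)) / ln r"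
      "\<forall>\<^sub>F r in at_top. ln (ln (m r)) / ln r \<le> (\<rho> * ln r + ln 2) / ln r"
    by (auto elim: eventually_mono)
  have "((\<lambda>r. ln (ln (m r)) / ln r) \<longlongrightarrow> \<rho>) at_top"
    by (rule tendsto_sandwich[OF ev2]) real_asymp+
  then have "((\<lambda>r. ereal (ln (ln (m r)) / ln r)) \<longlongrightarrow> ereal \<rho>) at_top"
    by (rule tendsto_ereal)
  then show "lower_growth_order g = ereal \<rho>" "growth_order g = ereal \<rho>"
    unfolding lower_growth_order_def growth_order_def m_def
    by (auto intro!: lim_imp_Liminf lim_imp_Limsup)
qed

text \<open>
  Comparison of the weight \<open>\<bar>z\<bar> powr (\<rho> - 1)\<close>, natural for large \<open>z\<close>, with one that is regular at the origin. The
  factor \<open>2\<close> is needed for \<open>\<rho> < 1\<close>, when the exponent is negative.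
\<close>

lemma powr_max_le:
  fixes x \<rho> :: real
  assumes "x \<ge> 0" "\<rho> \<ge> 0"
  shows "max 1 x powr (\<rho> - 1) \<le> 2 * (1 + x) powr (\<rho> - 1)"
proof (cases "\<rho> \<ge> 1")
  case True
  have "max 1 x powr (\<rho> - 1) \<le> (1 + x) powr (\<rho> - 1)"
    using True assms by (intro powr_mono2) auto
  then show ?thesis using powr_ge_zero[of "1 + x" "\<rho> - 1"] by linarith
next
  case False
  have "(2 * max 1 x) powr (\<rho> - 1) \<le> (1 + x) powr (\<rho> - 1)"
    using False assms by (intro powr_mono2') auto
  moreover have "(2 * max 1 x) powr (\<rho> - 1) = 2 powr (\<rho> - 1) * max 1 x powr (\<rho> - 1)"
    by (rule powr_mult)
  moreover have "(1/2) * max 1 x powr (\<rho> - 1) \<le> 2 powr (\<rho> - 1) * max 1 x powr (\<rho> - 1)"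
    using assms powr_mono[of "-1" "\<rho> - 1" "2::real"]
    by (intro mult_right_mono) (auto simp: powr_minus)
  ultimately show ?thesis by linarith
qed

text \<open>
  The disc of radius \<open>d\<close> around \<open>a\<close> avoids the origin, so \<open>Ln (exp (w t) / a)\<close> depends continuously on \<open>t\<close>
  and is bounded; it differs from \<open>w t\<close> by a continuous function with values in a translate of \<open>2\<pi>\<i>\<int>\<close>, hence by a constant.
\<close>

lemma bounded_of_exp_near:
  fixes w :: "real \<Rightarrow> complex"
  assumes cont: "continuous_on {T..} w" and near: "\<And>t. t \<ge> T \<Longrightarrow> norm (exp (w t) - a) \<le> d"
    and "d < norm a"
  shows "bounded (w ` {T..})"
proof -
  have "a \<noteq> 0" "d \<ge> 0"
    using order_trans[OF norm_ge_zero near[of T]] assms(3) by auto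
  define q where "q = (\<lambda>t. exp (w t) / a)"
  have q: "q t \<in> cball 1 (d / norm a)" if "t \<ge> T" for t
  proof -
    have "1 - q t = (a - exp (w t)) / a" using \<open>a \<noteq> 0\<close> by (simp add: q_def diff_divide_distrib)
    then show ?thesis
      using near[OF that] by (simp add: dist_norm norm_divide norm_minus_commute divide_right_mono)
  qed
  have pos: "z \<notin> \<real>\<^sub>\<le>\<^sub>0" if "z \<in> cball 1 (d / norm a)" for z :: complex
  proof -
    have "d / norm a < 1" using assms(3) \<open>a \<noteq> 0\<close> by simp
    then have "norm (1 - z) < 1" using that by (simp add: dist_norm)
    then have "Re z > 0" using abs_Re_le_cmod[of "1 - z"] by simp
    then show ?thesis by (auto simp: complex_nonpos_Reals_iff)
  qed
  define v where "v = (\<lambda>t. w t - Ln (q t))"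
  have contLn: "continuous_on (cball 1 (d / norm a)) Ln"
    using pos by (intro continuous_intros) auto
  have "continuous_on {T..} q"
    unfolding q_def using \<open>a \<noteq> 0\<close> cont by (intro continuous_intros) auto
  then have "continuous_on {T..} v"
    unfolding v_def using cont q
    by (intro continuous_intros continuous_on_compose2[OF contLn]) auto
  moreover have "\<exists>e>0. \<forall>y. y \<in> {T..} \<and> v y \<noteq> v x \<longrightarrow> e \<le> norm (v y - v x)" if "x \<in> {T..}" for x
  proof (intro exI[of _ "2 * pi"] conjI allI impI)
    fix y assume y: "y \<in> {T..} \<and> v y \<noteq> v x"
    have v: "exp (v t) = a" if "t \<in> {T..}" for t
    proof -
      have "q t \<noteq> 0" by (simp add: q_def \<open>a \<noteq> 0\<close>)
      then show ?thesis by (simp add: v_def exp_diff) (simp add: q_def)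
    qed
    have "\<bar>Im (v y) - Im (v x)\<bar> \<ge> 2 * pi"
      using exp_complex_eqI[of "v y" "v x"] v y that by force
    then show "2 * pi \<le> norm (v y - v x)"
      using abs_Im_le_cmod[of "v y - v x"] by simp
  qed simp
  ultimately obtain c where c: "\<And>t. t \<in> {T..} \<Longrightarrow> v t = c"
    using continuous_discrete_range_constant[of "{T..}" v] by (auto simp: constant_on_def)
  have "bounded (Ln ` cball 1 (d / norm a))"
    by (intro compact_imp_bounded compact_continuous_image contLn) simp
  then have "bounded ((\<lambda>z. c + z) ` Ln ` cball 1 (d / norm a))"
    by (rule bounded_translation)
  moreover have "w ` {T..} \<subseteq> (\<lambda>z. c + z) ` Ln ` cball 1 (d / norm a)"
  proof safe
    fix t :: real assume "T \<le> t"
    then have "w t = c + Ln (q t)" using c[of t] by (auto simp: v_def algebra_simps)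
    then show "w t \<in> (\<lambda>z. c + z) ` Ln ` cball 1 (d / norm a)" using q[OF \<open>T \<le> t\<close>] by blast
  qed
  ultimately show ?thesis by (rule bounded_subset)
qed

text \<open>
  The even part of the power series of \<open>f\<close> is a power series in \<open>u\<^sup>2\<close>.
\<close>

lemma even_part_holomorphic:
  fixes f :: "complex \<Rightarrow> complex"
  assumes "f holomorphic_on UNIV"
  obtains p where "p holomorphic_on UNIV" "\<And>u. p (u\<^sup>2) = f u + f (- u)"
proof -
  define a where "a = (\<lambda>n. (deriv ^^ n) f 0 / fact n)"
  have f: "(\<lambda>n. a n * u ^ n) sums f u" for u
  proof -
    have "f holomorphic_on ball 0 (norm u + 1)" using assms by (rule holomorphic_on_subset) auto
    from holomorphic_power_series[OF this, of u] show ?thesis by (simp add: a_def)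
  qed
  have even: "(\<lambda>n. 2 * a (2 * n) * (u\<^sup>2) ^ n) sums (f u + f (- u))" for u
  proof -
    have "(\<lambda>n. a n * u ^ n + a n * (- u) ^ n) sums (f u + f (- u))"
      by (intro sums_add f)
    moreover have "strict_mono (\<lambda>n::nat. 2 * n)" by (simp add: strict_mono_def)
    moreover have "a n * u ^ n + a n * (- u) ^ n = 0" if "n \<notin> range (\<lambda>n. 2 * n)" for n
      using that by (cases "even n") (auto simp: power_minus_odd elim!: evenE)
    ultimately have "(\<lambda>n. a (2 * n) * u ^ (2 * n) + a (2 * n) * (- u) ^ (2 * n)) sums (f u + f (- u))"
      using sums_mono_reindex[of "\<lambda>n. 2 * n" "\<lambda>n. a n * u ^ n + a n * (- u) ^ n"] by blast
    then show ?thesis by (simp add: power_mult mult.assoc)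
  qed
  define p where "p = (\<lambda>x. f (csqrt x) + f (- csqrt x))"
  have p: "(\<lambda>n. 2 * a (2 * n) * x ^ n) sums p x" for x
    using even[of "csqrt x"] by (simp add: p_def)
  show ?thesis
  proof (rule that[of p])
    have "p holomorphic_on ball 0 r" for r
      by (rule power_series_holomorphic[where a = "\<lambda>n. 2 * a (2 * n)"]) (use p in simp)
    then have "p field_differentiable at x" for x
      using holomorphic_on_imp_differentiable_at[of p "ball 0 (norm x + 1)" x] by simp
    then show "p holomorphic_on UNIV"
      by (simp add: holomorphic_on_def field_differentiable_at_within)
    show "p (u\<^sup>2) = f u + f (- u)" for u
      using sums_unique2[OF p[of "u\<^sup>2"] even[of u]] .
  qed
qed

section \<open>Functions of arbitrary order at least one half\<close>

text \<open>
  The function \<open>p\<close> halves the order: it has order \<open>s / 2\<close>, which runs through \<open>[1/2, 1)\<close>. Composition with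
  \<open>z ^ k\<close> multiplies the order by \<open>k\<close>.
\<close>

locale even_tract_function = tract_function +
  fixes k :: nat and p :: "complex \<Rightarrow> complex"
  assumes k: "k \<ge> 1"
    and p_hol: "p holomorphic_on UNIV"
    and p_square: "\<And>u. p (u\<^sup>2) = f u + f (- u)"
begin

definition F :: "complex \<Rightarrow> complex" where
  "F z = p (z ^ k)"

definition \<rho> :: real where
  "\<rho> = k * s / 2"

text \<open>
  The branch in the closed right half plane. It jumps where \<open>z ^ k\<close> is a negative number, but there it is imaginary,
  so that \<open>F\<close> is bounded near such points.
\<close>

definition root :: "complex \<Rightarrow> complex" where
  "root z = csqrt (z ^ k)"

lemma \<rho>_pos: "\<rho> > 0"
  using k s by (simp add: \<rho>_def)

lemma F_eq: "F z = f (root z) + f (- root z)"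
  using p_square[of "root z"] by (simp add: F_def root_def)

lemma F_holomorphic: "F holomorphic_on UNIV"
proof -
  have "(p \<circ> (\<lambda>z. z ^ k)) holomorphic_on UNIV"
    by (intro holomorphic_on_compose_gen[OF _ p_hol] holomorphic_intros) auto
  then show ?thesis by (simp add: F_def[abs_def] comp_def)
qed

lemma Re_root: "Re (root z) \<ge> 0"
  unfolding root_def by (rule Re_csqrt)

lemma norm_root:
  assumes "z \<noteq> 0"
  shows "norm (root z) = norm z powr (k / 2)"
  using assms by (simp add: root_def norm_power powr_half_sqrt[symmetric] powr_realpow[symmetric] powr_powr)

lemma norm_root_powr: "z \<noteq> 0 \<Longrightarrow> norm (root z) powr s = norm z powr \<rho>"
  by (simp add: norm_root powr_powr \<rho>_def)

lemma root_nonzero: "z \<noteq> 0 \<Longrightarrow> root z \<noteq> 0"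
  by (simp add: root_def)

lemma F_left: "Re (root z) \<le> 3 \<Longrightarrow> norm (F z) \<le> 2 * M"
  using left[of "root z"] left[of "- root z"] Re_root[of z] norm_triangle_ineq[of "f (root z)" "f (- root z)"]
  by (simp add: F_eq)

lemma F_right: "Re (root z) \<ge> 2 \<Longrightarrow> norm (F z - exp (root z powr of_real s)) \<le> 2 * M"
  using right[of "root z"] left[of "- root z"] Re_root[of z]
    norm_triangle_ineq[of "f (root z) - exp (root z powr of_real s)" "f (- root z)"]
  by (simp add: F_eq algebra_simps)

text \<open>
  The derivative of \<open>p\<close> is found by differentiating \<open>p(u\<^sup>2) = f(u) + f(- u)\<close>; no derivative of the discontinuous
  function \<open>root\<close> is needed.
\<close>

lemma deriv_F:
  assumes "z \<noteq> 0"
  shows "deriv F z = of_nat k * z ^ (k - 1) * ((deriv f (root z) - deriv f (- root z)) / (2 * root z))"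
proof -
  define u where "u = root z"
  have u: "u \<noteq> 0" "u\<^sup>2 = z ^ k" using assms root_nonzero by (auto simp: u_def root_def)
  have dp: "(p has_field_derivative deriv p x) (at x)" for x
    using p_hol by (simp add: holomorphic_derivI)
  have df: "(f has_field_derivative deriv f x) (at x)" for x
    using hol by (simp add: holomorphic_derivI)
  have "((\<lambda>u. p (u\<^sup>2)) has_field_derivative deriv p (u\<^sup>2) * (2 * u)) (at u)"
    by (rule DERIV_chain2[OF dp]) (auto intro!: derivative_eq_intros)
  moreover have "((\<lambda>u. f u + f (- u)) has_field_derivative deriv f u + deriv f (- u) * (- 1)) (at u)"
    by (intro DERIV_add df DERIV_chain2[OF df]) (auto intro!: derivative_eq_intros)
  ultimately have "deriv p (u\<^sup>2) * (2 * u) = deriv f u + deriv f (- u) * (- 1)"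
    unfolding p_square by (rule DERIV_unique)
  then have "deriv p (z ^ k) = (deriv f u - deriv f (- u)) / (2 * u)"
    using u by (simp add: field_simps)
  moreover have "(F has_field_derivative deriv p (z ^ k) * (of_nat k * z ^ (k - 1))) (at z)"
    unfolding F_def[abs_def] by (rule DERIV_chain2[OF dp]) (auto intro!: derivative_eq_intros)
  ultimately show ?thesis
    by (simp add: DERIV_imp_deriv u_def)
qed

text \<open>
  With \<open>r = \<bar>root z\<bar>\<close>, the exponents combine to
  \<open>(k - 1) + (k / 2) (s - 1) - k / 2 = \<rho> - 1\<close>. That \<open>s \<ge> 1\<close> makes \<open>r powr (s - 1) \<ge> 1\<close>, which lets
  the bounded error terms be absorbed.
\<close>

lemma norm_deriv_F_le_outside:
  assumes "norm z \<ge> 1"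
  shows "norm (deriv F z) \<le> k * (1 + 4 * M) * (1 + norm (F z)) * norm z powr (\<rho> - 1)"
proof -
  define r where "r = norm (root z)"
  have z: "z \<noteq> 0" using assms by auto
  have r: "r = norm z powr (k / 2)" "r \<ge> 1"
    using norm_root[OF z] assms by (auto simp: r_def ge_one_powr_ge_zero)
  have r1: "r powr (s - 1) \<ge> 1" using r s by (simp add: ge_one_powr_ge_zero)
  have "norm (deriv f (root z)) \<le> 2 * r powr (s - 1) * (norm (F z) + 2 * M) + 2 * M"
    using norm_deriv_le[of "root z"] r by (simp add: F_eq r_def)
  moreover have "norm (deriv f (- root z)) \<le> 2 * M"
    using Re_root[of z] by (intro deriv_left) simp
  moreover have "4 * M \<le> r powr (s - 1) * (4 * M)"
    using mult_right_mono[OF r1, of "4 * M"] M_nonneg by simp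
  moreover have "r powr (s - 1) * (2 * (norm (F z) + 2 * M) + 4 * M)
      \<le> r powr (s - 1) * (2 * (1 + 4 * M) * (1 + norm (F z)))"
    using M_nonneg by (intro mult_left_mono) (auto simp: algebra_simps)
  ultimately have "norm (deriv f (root z) - deriv f (- root z))
      \<le> r powr (s - 1) * (2 * (1 + 4 * M) * (1 + norm (F z)))"
    using norm_triangle_ineq4[of "deriv f (root z)" "deriv f (- root z)"] by (simp add: algebra_simps)
  then have "k * norm z ^ (k - 1) * (norm (deriv f (root z) - deriv f (- root z)) / (2 * r))
      \<le> k * norm z ^ (k - 1) * (r powr (s - 1) * (2 * (1 + 4 * M) * (1 + norm (F z))) / (2 * r))"
    using r(2) by (intro mult_left_mono divide_right_mono) auto
  also have "k * norm z ^ (k - 1) * (norm (deriv f (root z) - deriv f (- root z)) / (2 * r)) = norm (deriv F z)"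
    by (simp add: deriv_F[OF z] norm_mult norm_divide norm_power r_def)
  finally have "norm (deriv F z)
      \<le> k * norm z ^ (k - 1) * (r powr (s - 1) * (2 * (1 + 4 * M) * (1 + norm (F z))) / (2 * r))" .
  also have "\<dots> = k * (1 + 4 * M) * (1 + norm (F z)) * (norm z ^ (k - 1) * (r powr (s - 1) / r))"
    using r(2) by (simp add: divide_simps) (simp add: algebra_simps)
  also have "norm z ^ (k - 1) * (r powr (s - 1) / r) = norm z powr (\<rho> - 1)"
  proof -
    have "norm z ^ (k - 1) = norm z powr (real k - 1)"
      using z k by (simp add: powr_realpow[symmetric] of_nat_diff)
    moreover have "r powr (s - 1) / r = norm z powr (k / 2 * (s - 1) - k / 2)"
      unfolding r(1) powr_powr by (rule powr_diff[symmetric])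
    moreover have "real k - 1 + (k / 2 * (s - 1) - k / 2) = \<rho> - 1"
      by (simp add: \<rho>_def field_simps)
    ultimately show ?thesis
      by (simp only: powr_add[symmetric])
  qed
  finally show ?thesis .
qed

lemma norm_deriv_F_le:
  obtains C where "\<And>z. norm (deriv F z) \<le> C * (1 + norm (F z)) * (1 + norm z) powr (\<rho> - 1)"
proof -
  have "deriv F holomorphic_on UNIV" using F_holomorphic by (intro holomorphic_deriv) auto
  then have "continuous_on (cball 0 1) (deriv F)"
    by (intro holomorphic_on_imp_continuous_on) (rule holomorphic_on_subset, auto)
  then have "bounded (deriv F ` cball 0 1)"
    by (intro compact_imp_bounded compact_continuous_image) auto
  then obtain B where "\<forall>z\<in>cball 0 1. norm (deriv F z) \<le> B"
    by (auto simp: bounded_iff)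
  then have B: "norm (deriv F z) \<le> B" if "norm z \<le> 1" for z
    using that by simp
  define D where "D = max B (k * (1 + 4 * M))"
  have D: "D \<ge> 0" using M_nonneg by (auto simp: D_def le_max_iff_disj)
  show ?thesis
  proof (rule that[of "2 * D"])
    fix z
    have "norm (deriv F z) \<le> D * (1 + norm (F z)) * max 1 (norm z) powr (\<rho> - 1)"
    proof (cases "norm z \<le> 1")
      case True
      have "B * 1 \<le> D * (1 + norm (F z))" using D by (intro mult_mono) (auto simp: D_def)
      then show ?thesis using B[OF True] True by (simp add: max_absorb1)
    next
      case False
      have "k * (1 + 4 * M) * (1 + norm (F z)) * norm z powr (\<rho> - 1)
          \<le> D * (1 + norm (F z)) * norm z powr (\<rho> - 1)"
        by (intro mult_right_mono) (auto simp: D_def)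
      then show ?thesis
        using norm_deriv_F_le_outside[of z] False by (simp add: max_absorb2)
    qed
    also have "\<dots> \<le> D * (1 + norm (F z)) * (2 * (1 + norm z) powr (\<rho> - 1))"
      using powr_max_le[of "norm z" \<rho>] \<rho>_pos D by (intro mult_left_mono) auto
    finally show "norm (deriv F z) \<le> 2 * D * (1 + norm (F z)) * (1 + norm z) powr (\<rho> - 1)"
      by (simp only: mult_ac)
  qed
qed

lemma bounded_critical_values: "bounded (critical_values F)"
proof -
  have "norm (F z) \<le> 6 * M" if "deriv F z = 0" "z \<noteq> 0" for z
  proof -
    have "deriv f (root z) = deriv f (- root z)"
      using that k root_nonzero[OF that(2)] by (simp add: deriv_F)
    then show ?thesis
      using norm_even_part_le_of_critical[OF Re_root] by (simp add: F_eq)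
  qed
  then have "norm (F z) \<le> max (norm (F 0)) (6 * M)" if "deriv F z = 0" for z
    using that by (cases "z = 0") (auto simp: le_max_iff_disj)
  then show ?thesis
    by (auto simp: critical_values_def bounded_iff)
qed

text \<open>
  If \<open>F\<close> tends to a large value along a curve, then the curve eventually stays in the region \<open>Re (root z) > 3\<close>. There
  \<open>root\<close> is continuous and the exponential of its power stays close to the limit, so the power is bounded. But the power
  has modulus \<open>\<bar>z\<bar> powr \<rho>\<close>, which is unbounded on the curve.
\<close>

lemma asymptotic_value_bound:
  assumes "a \<in> asymptotic_values F"
  shows "norm a \<le> 4 * M + 1"
proof (rule ccontr)
  assume a: "\<not> norm a \<le> 4 * M + 1"
  obtain \<gamma> :: "real \<Rightarrow> complex" where \<gamma>: "continuous_on {0..} \<gamma>" "filterlim \<gamma> at_infinity at_top"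
    "((\<lambda>t. F (\<gamma> t)) \<longlongrightarrow> a) at_top"
    using assms by (auto simp: asymptotic_values_def)
  have "\<forall>\<^sub>F t in at_top. dist (F (\<gamma> t)) a < 1" using tendstoD[OF \<gamma>(3)] by simp
  moreover have "\<forall>\<^sub>F t in at_top. \<gamma> t \<noteq> 0"
    using \<gamma>(2) filterlim_at_infinity_imp_eventually_ne by blast
  ultimately have "\<forall>\<^sub>F t in at_top. t \<ge> 0 \<and> dist (F (\<gamma> t)) a < 1 \<and> \<gamma> t \<noteq> 0"
    using eventually_ge_at_top[of 0] by eventually_elim auto
  then obtain T where T: "\<And>t. t \<ge> T \<Longrightarrow> t \<ge> 0 \<and> norm (F (\<gamma> t) - a) < 1 \<and> \<gamma> t \<noteq> 0"
    unfolding eventually_at_top_linorder by (auto simp: dist_norm)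
  have Re3: "Re (root (\<gamma> t)) > 3" if "t \<ge> T" for t
  proof (rule ccontr)
    assume "\<not> Re (root (\<gamma> t)) > 3"
    then have "norm (F (\<gamma> t)) \<le> 2 * M" using F_left[of "\<gamma> t"] by auto
    then show False
      using a M_nonneg T[OF that] norm_triangle_ineq4[of "F (\<gamma> t)" "F (\<gamma> t) - a"] by simp
  qed
  have "(\<gamma> t) ^ k \<notin> \<real>\<^sub>\<le>\<^sub>0" if "t \<ge> T" for t
  proof
    assume "(\<gamma> t) ^ k \<in> \<real>\<^sub>\<le>\<^sub>0"
    then have "Re (root (\<gamma> t)) = 0"
      by (auto simp: root_def complex_nonpos_Reals_iff)
    then show False using Re3[OF that] by simp
  qed
  moreover have "continuous_on {T..} \<gamma>"
    using T[of T] by (intro continuous_on_subset[OF \<gamma>(1)]) auto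
  ultimately have "continuous_on {T..} (csqrt \<circ> (\<lambda>t. \<gamma> t ^ k))"
    by (intro continuous_on_compose continuous_on_subset[OF continuous_on_csqrt] continuous_intros) auto
  then have "continuous_on {T..} (\<lambda>t. root (\<gamma> t))"
    by (simp add: root_def comp_def)
  then have "continuous_on {T..} (\<lambda>t. root (\<gamma> t) powr of_real s)"
    using Re3 by (intro continuous_intros) (force simp: complex_nonpos_Reals_iff)+
  moreover have "norm (exp (root (\<gamma> t) powr of_real s) - a) \<le> 2 * M + 1" if "t \<ge> T" for t
    using F_right[of "\<gamma> t"] Re3[OF that] T[OF that]
      norm_triangle_ineq4[of "F (\<gamma> t) - a" "F (\<gamma> t) - exp (root (\<gamma> t) powr of_real s)"] by simp
  moreover have "2 * M + 1 < norm a" using a M_nonneg by simp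
  ultimately have "bounded ((\<lambda>t. root (\<gamma> t) powr of_real s) ` {T..})"
    by (rule bounded_of_exp_near)
  then obtain B where B: "\<And>t. t \<ge> T \<Longrightarrow> norm (root (\<gamma> t) powr of_real s) \<le> B"
    by (auto simp: bounded_iff)
  have "norm (\<gamma> t) powr \<rho> \<le> B" if "t \<ge> T" for t
    using B[OF that] T[OF that] norm_powr_of_real[OF root_nonzero, of "\<gamma> t" s]
    by (simp add: norm_root_powr)
  moreover define R where "R = (\<bar>B\<bar> + 1) powr (1 / \<rho>)"
  have R: "R powr \<rho> = \<bar>B\<bar> + 1" using \<rho>_pos by (simp add: R_def powr_powr)
  have "\<forall>\<^sub>F t in at_top. norm (\<gamma> t) \<ge> R"
    using \<gamma>(2) by (auto simp: filterlim_at_infinity[of 0] filterlim_at_infinity_conv_norm_at_top filterlim_at_top)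
  then have "\<forall>\<^sub>F t in at_top. t \<ge> T \<and> norm (\<gamma> t) \<ge> R"
    using eventually_ge_at_top[of T] by eventually_elim auto
  then obtain t where "t \<ge> T" "norm (\<gamma> t) \<ge> R"
    using eventually_happens'[OF trivial_limit_at_top_linorder] by blast
  moreover from this have "norm (\<gamma> t) powr \<rho> \<ge> R powr \<rho>"
    using \<rho>_pos by (intro powr_mono2) (auto simp: R_def)
  ultimately show False using R by fastforce
qed

lemma F_lower:
  assumes "r \<ge> 4"
  shows "exp (r powr \<rho>) - 2 * M \<le> norm (F (of_real r))"
proof -
  have root: "root (of_real r) = of_real (sqrt (r ^ k))"
    using assms by (simp add: root_def csqrt_of_real flip: of_real_power)
  have "4 \<le> r ^ k"
    using assms k power_increasing[of 1 k r] by simp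
  then have "sqrt 4 \<le> sqrt (r ^ k)" by (rule real_sqrt_le_mono)
  then have Re: "Re (root (of_real r)) \<ge> 2" by (simp add: root)
  have "Re (root (of_real r) powr of_real s) = sqrt (r ^ k) powr s"
    using assms by (simp add: root powr_of_real)
  also have "\<dots> = r powr \<rho>"
    using norm_root_powr[of "of_real r"] assms by (simp add: root)
  finally show ?thesis
    using F_right[OF Re] norm_triangle_ineq3[of "F (of_real r)" "exp (root (of_real r) powr of_real s)"]
    by simp
qed

lemma F_upper:
  assumes "norm z \<ge> 1"
  shows "norm (F z) \<le> exp (norm z powr \<rho>) + 2 * M"
proof (cases "Re (root z) \<le> 3")
  case True
  then show ?thesis using F_left[of z] exp_ge_zero[of "norm z powr \<rho>"] by linarith
next
  case False
  have z: "z \<noteq> 0" using assms by auto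
  have "norm (exp (root z powr of_real s)) \<le> exp (norm z powr \<rho>)"
    using norm_exp[of "root z powr of_real s"] z
    by (simp add: norm_powr_of_real[OF root_nonzero[OF z]] norm_root_powr)
  moreover have "norm (F z - exp (root z powr of_real s)) \<le> 2 * M"
    using False by (intro F_right) simp
  ultimately show ?thesis
    using norm_triangle_sub[of "F z" "exp (root z powr of_real s)"] by linarith
qed

lemma orders_F: "lower_growth_order F = ereal \<rho>" "growth_order F = ereal \<rho>"
proof -
  have "\<forall>\<^sub>F r in at_top. exp (r powr \<rho>) - 2 * M \<le> norm (F (of_real r))"
    using eventually_ge_at_top[of 4] by eventually_elim (rule F_lower)
  then show "lower_growth_order F = ereal \<rho>" "growth_order F = ereal \<rho>"
    using orders_eqI[OF holomorphic_on_imp_continuous_on[OF F_holomorphic] \<rho>_pos F_upper] by auto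
qed

text \<open>
  On a ray where \<open>z ^ k\<close> is negative, \<open>F\<close> is bounded, so a polynomial agreeing with \<open>F\<close> would be constant; but \<open>F\<close> is
  unbounded on the positive axis.
\<close>

lemma F_not_polynomial: "F \<noteq> poly q"
proof
  assume F: "F = poly q"
  obtain c q' where q: "q = pCons c q'" by (cases q)
  define \<omega> where "\<omega> = exp (\<i> * pi / k)"
  have \<omega>: "\<omega> ^ k = - 1" "norm \<omega> = 1"
    using k by (auto simp: \<omega>_def exp_of_nat_mult[symmetric] norm_exp_eq_Re)
  have bounded_ray: "norm (F (of_real r * \<omega>)) \<le> 2 * M" if "r \<ge> 0" for r
  proof -
    have "root (of_real r * \<omega>) = csqrt (of_real (- (r ^ k)))"
      using \<omega> by (simp add: root_def power_mult_distrib)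
    also have "\<dots> = \<i> * sqrt (r ^ k)"
      using csqrt_of_real_nonpos[of "of_real (- (r ^ k))"] that by simp
    finally have "Re (root (of_real r * \<omega>)) = 0" by simp
    then show ?thesis by (intro F_left) simp
  qed
  show False
  proof (cases "q' = 0")
    case True
    have "filterlim (\<lambda>r. exp (r powr \<rho>) - 2 * M) at_top at_top"
      using \<rho>_pos by real_asymp
    then have "\<forall>\<^sub>F r in at_top. exp (r powr \<rho>) - 2 * M > norm c"
      by (simp add: filterlim_at_top_dense)
    then have "\<forall>\<^sub>F r in at_top. norm (F (of_real r)) > norm c"
      using eventually_ge_at_top[of 4] by eventually_elim (use F_lower in fastforce)
    then show False
      using F q True by simp
  next
    case False
    obtain R where R: "\<And>z. R \<le> norm z \<Longrightarrow> 2 * M + 1 \<le> norm (F z)"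
      using poly_infinity[OF False, of "2 * M + 1" c] F q by auto
    have "2 * M + 1 \<le> norm (F (of_real \<bar>R\<bar> * \<omega>))"
      using \<omega> by (intro R) (simp add: norm_mult)
    then show False using bounded_ray[of "\<bar>R\<bar>"] by simp
  qed
qed

lemma F_in_class: "F \<in> eremenko_lyubich_class"
proof -
  have "bounded (asymptotic_values F)"
    using asymptotic_value_bound by (auto simp: bounded_iff)
  then show ?thesis
    using F_holomorphic F_not_polynomial bounded_critical_values
    by (auto simp: eremenko_lyubich_class_def transcendental_entire_def)
qed

end

section \<open>Sharpness of the growth bound\<close>

theorem theorem1p6:
  fixes \<rho> :: real
  assumes "\<rho> \<ge> 1 / 2"
  shows "\<exists>f \<in> eremenko_lyubich_class.
           lower_growth_order f = ereal \<rho> \<and> growth_order f = ereal \<rho> \<and>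
           (\<forall>z. infinite_lyapunov_exponent f z \<longrightarrow>
              limsup (\<lambda>n. ereal (1 / real n * ln (ln (spherical_deriv (f ^^ n) z)))) \<le> ereal (ln (1 + \<rho>)))"
proof -
  \<comment> \<open>With \<open>k\<close> the integer part of \<open>2\<rho> \<ge> 1\<close>, the quotient \<open>s = 2\<rho> / k\<close> is less than \<open>(k + 1) / k \<le> 2\<close>.\<close>
  define k where "k = nat \<lfloor>2 * \<rho>\<rfloor>"
  define s where "s = 2 * \<rho> / k"
  have k: "k \<ge> 1" using assms by (simp add: k_def le_nat_iff le_floor_iff)
  have "real k \<le> 2 * \<rho>" "2 * \<rho> < real k + 1" using assms by (auto simp: k_def)
  then have s: "1 \<le> s" "s < 2" using k by (auto simp: s_def field_simps)
  obtain M f where "tract_function s M f" using tract_function_exists[OF s] by blast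
  then interpret t: tract_function s M f .
  obtain p where "p holomorphic_on UNIV" "\<And>u. p (u\<^sup>2) = f u + f (- u)"
    using even_part_holomorphic[OF t.hol] by blast
  then interpret e: even_tract_function s M f k p
    using k by unfold_locales auto
  have \<rho>: "e.\<rho> = \<rho>" unfolding e.\<rho>_def using k by (simp add: s_def)
  obtain C where "\<And>z. norm (deriv e.F z) \<le> C * (1 + norm (e.F z)) * (1 + norm z) powr (\<rho> - 1)"
    using e.norm_deriv_F_le unfolding \<rho> by blast
  then have "limsup (\<lambda>n. ereal (1 / real n * ln (ln (spherical_deriv (e.F ^^ n) z)))) \<le> ereal (ln (1 + \<rho>))"
    if "infinite_lyapunov_exponent e.F z" for z
    using that assms by (intro limsup_log_log_spherical_deriv_le[OF e.F_holomorphic]) auto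
  then show ?thesis
    using e.F_in_class e.orders_F unfolding \<rho> by blast
qed

end
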